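(* Let $a_1,a_3>0$, $l_1,l_2,l_3>0$ with $l_1+l_2+l_3=1$, $\varepsilon\in(0,1)$, and $\tau\in[-\pi,\pi)$ with $\xi(\tau)\ne0$. Let $A^{\rm hom}_\tau$, $\Gamma_\tau$, $v$, $A_{\rm D}$, $\sigma$, $\theta$ be as in the context. Let $z\in\mathbb C$ with $l_2\sqrt z\notin\pi\mathbb Z$, and set $$ K(\tau,z):=\frac1{l_1+l_3}\left\{z\,\Gamma_\tau\begin{pmatrix}(A_{\rm D}-zI)^{-1}v\\ 0\end{pmatrix}+\Gamma_\tau\begin{pmatrix}v\\ \sqrt{l_1+l_3}\end{pmatrix}\right\}. $$ Then for a pair $(u,\beta)\in{\rm dom}(A^{\rm hom}_\tau)$ whose first component satisfies $-\bigl(\frac{d}{dx}+i\tau\bigr)^2u=zu$ on $(0,l_2)$, the second ("boundary") component of the spectral equation $A^{\rm hom}_\tau(u,\beta)^\top=z(u,\beta)^\top$ is equivalent to $$K(\tau,z)\beta=z\beta,$$ and $$ K(\tau,z)=\frac{1}{l_1+l_3}\left\{\frac{2\sqrt z\cos(l_2\sqrt z)}{\sin(l_2\sqrt z)}-\frac{2\sqrt z}{\sin(l_2\sqrt z)}\,\Re\theta(\tau)+\Bigl(\frac{\sigma\tau}{\varepsilon}\Bigr)^2\right\}. $$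
   Context: Notation: $\xi(\tau)=-\frac{a_1^2}{l_1}e^{i\tau(l_1+l_3)}-\frac{a_3^2}{l_3}e^{-i\tau l_2}$, $w_\tau=-\xi/|\xi|$, $t=\tau/\varepsilon$, $\sigma^2=\Bigl(\frac{l_1}{a_1^2}+\frac{l_3}{a_3^2}\Bigr)^{-1}$, and $$\theta(\tau)=\frac{\frac{a_1^2}{l_1}e^{-i\tau}+\frac{a_3^2}{l_3}}{\Bigl|\frac{a_1^2}{l_1}e^{-i\tau}+\frac{a_3^2}{l_3}\Bigr|}.$$ The map $\Gamma_\tau:W^{2,2}(0,l_2)\oplus\mathbb C\to\mathbb C$ is $$\Gamma_\tau\begin{pmatrix}u\\ \beta\end{pmatrix}=-(u'+i\tau u)(0)+\overline{w_\tau}\,(u'+i\tau u)(l_2)+\frac{(\sigma t)^2}{\sqrt{l_1+l_3}}\,\beta .$$ The operator $A^{\rm hom}_\tau$ in $L^2(0,l_2)\oplus\mathbb C$ has domain consisting of all pairs $(u,\beta)$ with $u\in W^{2,2}(0,l_2)$ and $$u(0)=\overline{w_\tau}\,u(l_2)=\frac{\beta}{\sqrt{l_1+l_3}},$$ and acts by $$A^{\rm hom}_\tau\begin{pmatrix}u\\ \beta\end{pmatrix}=\begin{pmatrix}\bigl(\frac1i\frac{d}{dx}+\tau\bigr)^2u\\[2pt] \frac1{\sqrt{l_1+l_3}}\Gamma_\tau\begin{pmatrix}u\\ \beta\end{pmatrix}\end{pmatrix}.$$ $v$ is the solution of $-\bigl(\frac{d}{dx}+i\tau\bigr)^2v=0$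 on $(0,l_2)$, $v(0)=1$, $v(l_2)=w_\tau$, i.e. $v(x)=\bigl\{1+l_2^{-1}(w_\tau e^{i\tau l_2}-1)x\bigr\}e^{-i\tau x}$. $A_{\rm D}$ is the operator in $L^2(0,l_2)$ given by $-\bigl(\frac{d}{dx}+i\tau\bigr)^2$ with Dirichlet boundary conditions at $0$ and $l_2$; its eigenvalues are $(\pi j/l_2)^2$, $j=1,2,\dots$ *)

theory Defs
  imports "HOL-Analysis.Analysis"
begin

section \<open>Sobolev spaces on a bounded interval\<close>

text \<open>
  Elements of \<open>L\<^sup>2(0,l)\<close> and of the Sobolev spaces are represented by functions on the real line;
  only their values almost everywhere on \<open>(0,l)\<close> matter, and equations between them are
  read almost everywhere. The weak derivative is the one-dimensional definition with
  \<open>C\<^sup>1\<close> test functions of compact support in \<open>(0,l)\<close> (Brezis, Functional Analysis, Sobolev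
  Spaces and Partial Differential Equations, Section 8.2), and \<open>W\<^sup>2\<^sup>,\<^sup>2\<close> is
  obtained by iteration.
\<close>

definition L2 :: "real \<Rightarrow> (real \<Rightarrow> complex) set" where
  "L2 l = {u. u \<in> borel_measurable (lebesgue_on {0<..<l}) \<and>
              integrable (lebesgue_on {0<..<l}) (\<lambda>x. (cmod (u x))\<^sup>2)}"

definition test_functions :: "real \<Rightarrow> (real \<Rightarrow> complex) set" where
  "test_functions l = {\<phi>. \<phi> C1_differentiable_on UNIV \<and> closure {x. \<phi> x \<noteq> 0} \<subseteq> {0<..<l}}"

definition is_weak_deriv :: "real \<Rightarrow> (real \<Rightarrow> complex) \<Rightarrow> (real \<Rightarrow> complex) \<Rightarrow> bool" where
  "is_weak_deriv l u g \<longleftrightarrow>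
     (\<forall>\<phi>\<in>test_functions l.
        (LINT x|lebesgue_on {0<..<l}. u x * vector_derivative \<phi> (at x))
          = - (LINT x|lebesgue_on {0<..<l}. g x * \<phi> x))"

definition W12 :: "real \<Rightarrow> (real \<Rightarrow> complex) set" where
  "W12 l = {u \<in> L2 l. \<exists>g\<in>L2 l. is_weak_deriv l u g}"

text \<open>The weak derivative is unique up to a null set, so the choice below is immaterial.\<close>

definition wderiv :: "real \<Rightarrow> (real \<Rightarrow> complex) \<Rightarrow> real \<Rightarrow> complex" where
  "wderiv l u = (SOME g. g \<in> L2 l \<and> is_weak_deriv l u g)"

definition W22 :: "real \<Rightarrow> (real \<Rightarrow> complex) set" where
  "W22 l = {u \<in> W12 l. wderiv l u \<in> W12 l}"

text \<open>
  Point values on \<open>[0,l]\<close>, in particular at the end points, are those of the continuous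
  representative, which exists for every element of \<open>W12 l\<close>.
\<close>

definition pointval :: "real \<Rightarrow> (real \<Rightarrow> complex) \<Rightarrow> real \<Rightarrow> complex" where
  "pointval l u x =
     (THE c. \<exists>g. continuous_on {0..l} g \<and> (AE y in lebesgue_on {0<..<l}. g y = u y) \<and> c = g x)"

text \<open>The differential expressions \<open>d/dx + i\<tau>\<close> and \<open>(1/i) d/dx + \<tau>\<close>.\<close>

definition ddx_plus :: "real \<Rightarrow> real \<Rightarrow> (real \<Rightarrow> complex) \<Rightarrow> real \<Rightarrow> complex" where
  "ddx_plus l \<tau> u = (\<lambda>x. wderiv l u x + \<i> * of_real \<tau> * u x)"

definition Dtau :: "real \<Rightarrow> real \<Rightarrow> (real \<Rightarrow> complex) \<Rightarrow> real \<Rightarrow> complex" where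
  "Dtau l \<tau> u = (\<lambda>x. (1 / \<i>) * wderiv l u x + of_real \<tau> * u x)"


section \<open>The Dirichlet operator\<close>

definition dom_AD :: "real \<Rightarrow> (real \<Rightarrow> complex) set" where
  "dom_AD l = {u \<in> W22 l. pointval l u 0 = 0 \<and> pointval l u l = 0}"

definition AD :: "real \<Rightarrow> real \<Rightarrow> (real \<Rightarrow> complex) \<Rightarrow> real \<Rightarrow> complex" where
  "AD l \<tau> u = (\<lambda>x. - ddx_plus l \<tau> (ddx_plus l \<tau> u) x)"

text \<open>
  \<open>(A\<^sub>D - zI)\<^sup>-\<^sup>1 f\<close>: the preimage of \<open>f\<close>, which for \<open>z\<close> in the resolvent set exists and is
  unique up to a null set.
\<close>

definition AD_resolvent :: "real \<Rightarrow> real \<Rightarrow> complex \<Rightarrow> (real \<Rightarrow> complex) \<Rightarrow> real \<Rightarrow> complex" where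
  "AD_resolvent l \<tau> z f =
     (SOME u. u \<in> dom_AD l \<and> (AE x in lebesgue_on {0<..<l}. AD l \<tau> u x - z * u x = f x))"


section \<open>The homogenised operator\<close>

definition xi :: "real \<Rightarrow> real \<Rightarrow> real \<Rightarrow> real \<Rightarrow> real \<Rightarrow> real \<Rightarrow> complex" where
  "xi a1 a3 l1 l2 l3 \<tau> =
     - of_real (a1\<^sup>2 / l1) * exp (\<i> * of_real (\<tau> * (l1 + l3)))
     - of_real (a3\<^sup>2 / l3) * exp (- \<i> * of_real (\<tau> * l2))"

definition wtau :: "real \<Rightarrow> real \<Rightarrow> real \<Rightarrow> real \<Rightarrow> real \<Rightarrow> real \<Rightarrow> complex" where
  "wtau a1 a3 l1 l2 l3 \<tau> = - xi a1 a3 l1 l2 l3 \<tau> / of_real (cmod (xi a1 a3 l1 l2 l3 \<tau>))"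

definition sigma_hom :: "real \<Rightarrow> real \<Rightarrow> real \<Rightarrow> real \<Rightarrow> real" where
  "sigma_hom a1 a3 l1 l3 = sqrt (inverse (l1 / a1\<^sup>2 + l3 / a3\<^sup>2))"

definition theta :: "real \<Rightarrow> real \<Rightarrow> real \<Rightarrow> real \<Rightarrow> real \<Rightarrow> complex" where
  "theta a1 a3 l1 l3 \<tau> =
     (of_real (a1\<^sup>2 / l1) * exp (- \<i> * of_real \<tau>) + of_real (a3\<^sup>2 / l3)) /
     of_real (cmod (of_real (a1\<^sup>2 / l1) * exp (- \<i> * of_real \<tau>) + of_real (a3\<^sup>2 / l3)))"

definition Gamma_tau :: "real \<Rightarrow> real \<Rightarrow> real \<Rightarrow> real \<Rightarrow> real \<Rightarrow> real \<Rightarrow> real \<Rightarrow>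
    (real \<Rightarrow> complex) \<times> complex \<Rightarrow> complex" where
  "Gamma_tau a1 a3 l1 l2 l3 \<epsilon> \<tau> = (\<lambda>(u, \<beta>).
     - pointval l2 (ddx_plus l2 \<tau> u) 0
     + cnj (wtau a1 a3 l1 l2 l3 \<tau>) * pointval l2 (ddx_plus l2 \<tau> u) l2
     + of_real ((sigma_hom a1 a3 l1 l3 * (\<tau> / \<epsilon>))\<^sup>2 / sqrt (l1 + l3)) * \<beta>)"

definition dom_Ahom :: "real \<Rightarrow> real \<Rightarrow> real \<Rightarrow> real \<Rightarrow> real \<Rightarrow> real \<Rightarrow>
    ((real \<Rightarrow> complex) \<times> complex) set" where
  "dom_Ahom a1 a3 l1 l2 l3 \<tau> = {(u, \<beta>). u \<in> W22 l2 \<and>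
     pointval l2 u 0 = cnj (wtau a1 a3 l1 l2 l3 \<tau>) * pointval l2 u l2 \<and>
     cnj (wtau a1 a3 l1 l2 l3 \<tau>) * pointval l2 u l2 = \<beta> / of_real (sqrt (l1 + l3))}"

definition Ahom :: "real \<Rightarrow> real \<Rightarrow> real \<Rightarrow> real \<Rightarrow> real \<Rightarrow> real \<Rightarrow> real \<Rightarrow>
    (real \<Rightarrow> complex) \<times> complex \<Rightarrow> (real \<Rightarrow> complex) \<times> complex" where
  "Ahom a1 a3 l1 l2 l3 \<epsilon> \<tau> = (\<lambda>(u, \<beta>).
     (Dtau l2 \<tau> (Dtau l2 \<tau> u),
      of_real (1 / sqrt (l1 + l3)) * Gamma_tau a1 a3 l1 l2 l3 \<epsilon> \<tau> (u, \<beta>)))"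

definition vtau :: "real \<Rightarrow> real \<Rightarrow> real \<Rightarrow> real \<Rightarrow> real \<Rightarrow> real \<Rightarrow> real \<Rightarrow> complex" where
  "vtau a1 a3 l1 l2 l3 \<tau> x =
     (1 + of_real (1 / l2) * (wtau a1 a3 l1 l2 l3 \<tau> * exp (\<i> * of_real (\<tau> * l2)) - 1) * of_real x)
     * exp (- \<i> * of_real (\<tau> * x))"

lemma vtau_boundary:
  assumes "l2 \<noteq> 0"
  shows "vtau a1 a3 l1 l2 l3 \<tau> 0 = 1"
    and "vtau a1 a3 l1 l2 l3 \<tau> l2 = wtau a1 a3 l1 l2 l3 \<tau>"
  using assms by (simp_all add: vtau_def mult.assoc exp_minus field_simps)

lemma vtau_ode:
  fixes a1 a3 l1 l2 l3 \<tau> x :: real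
  defines "v \<equiv> vtau a1 a3 l1 l2 l3 \<tau>"
  defines "q \<equiv> (\<lambda>x. vector_derivative v (at x) + \<i> * of_real \<tau> * v x)"
  shows "v differentiable (at x)" "q differentiable (at x)"
    and "- (vector_derivative q (at x) + \<i> * of_real \<tau> * q x) = 0"
proof -
  define c where "c = of_real (1 / l2) * (wtau a1 a3 l1 l2 l3 \<tau> * exp (\<i> * of_real (\<tau> * l2)) - 1)"
  define e where "e = (\<lambda>x::real. exp (- \<i> * of_real (\<tau> * x)))"
  have e: "(e has_vector_derivative - \<i> * of_real \<tau> * e x) (at x)" for x
    unfolding e_def
    by (rule derivative_eq_intros has_vector_derivative_real_field refl | simp)+
  have v_eq: "v = (\<lambda>x. (1 + c * of_real x) * e x)"
    by (simp add: fun_eq_iff v_def vtau_def c_def e_def)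
  have v: "(v has_vector_derivative c * e x - \<i> * of_real \<tau> * v x) (at x)" for x
    unfolding v_eq
    by (rule derivative_eq_intros e refl | simp add: algebra_simps)+
  have q_eq: "q = (\<lambda>x. c * e x)"
    by (simp add: fun_eq_iff q_def vector_derivative_at [OF v])
  have q: "(q has_vector_derivative - \<i> * of_real \<tau> * q x) (at x)" for x
    unfolding q_eq
    by (rule derivative_eq_intros e refl | simp add: algebra_simps)+
  show "v differentiable (at x)" "q differentiable (at x)"
    using v q by (auto intro: differentiableI_vector)
  show "- (vector_derivative q (at x) + \<i> * of_real \<tau> * q x) = 0"
    by (simp add: vector_derivative_at [OF q])
qed

definition Ktau :: "real \<Rightarrow> real \<Rightarrow> real \<Rightarrow> real \<Rightarrow> real \<Rightarrow> real \<Rightarrow> real \<Rightarrow> complex \<Rightarrow> complex" where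
  "Ktau a1 a3 l1 l2 l3 \<epsilon> \<tau> z =
     of_real (1 / (l1 + l3)) *
       (z * Gamma_tau a1 a3 l1 l2 l3 \<epsilon> \<tau> (AD_resolvent l2 \<tau> z (vtau a1 a3 l1 l2 l3 \<tau>), 0)
        + Gamma_tau a1 a3 l1 l2 l3 \<epsilon> \<tau> (vtau a1 a3 l1 l2 l3 \<tau>, of_real (sqrt (l1 + l3))))"

end

theory Submission
  imports Defs
begin

text \<open>
  A weak solution \<open>u\<close> of \<open>-(d/dx + i\<tau>)\<^sup>2 u = z u\<close>, with \<open>q = u' + i\<tau>u\<close>, solves a first-order
  system that is diagonalised by \<open>q \<plusminus> i\<surd>z u\<close>; after multiplication by an exponential these
  combinations have weak derivative zero, so they are constant and \<open>u\<close> is a combination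
  of two explicit exponentials. If \<open>u\<close> has boundary values \<open>\<mu>\<close> and \<open>\<mu> w\<^sub>\<tau>\<close>, the flux jump in \<open>\<Gamma>\<^sub>\<tau>\<close> is then
  \<open>\<mu>\<close> times an explicit factor \<open>H\<close>. This applies both to the first component of an element of the domain
  of \<open>A\<^sup>h\<^sup>o\<^sup>m\<close> (with \<open>\<mu> = \<beta>/\<surd>(l\<^sub>1 + l\<^sub>3)\<close>) and to \<open>z (A\<^sub>D - z)\<^sup>-\<^sup>1 v + v\<close> (with \<open>\<mu> = 1\<close>), which yields
  \<open>K\<close> and the equivalence at once.
\<close>

subsection \<open>Square-integrable functions on an interval\<close>

lemma finite_measure_lebesgue_on_interval: "finite_measure (lebesgue_on {a<..<b::real})"
proof
  show "emeasure (lebesgue_on {a<..<b}) (space (lebesgue_on {a<..<b})) \<noteq> \<infinity>"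
    by (cases "a \<le> b") (simp_all add: emeasure_restrict_space)
qed

lemma continuous_imp_L2:
  assumes "continuous_on {0..l} f"
  shows "f \<in> L2 l"
proof -
  interpret finite_measure "lebesgue_on {0<..<l}"
    by (rule finite_measure_lebesgue_on_interval)
  have meas: "f \<in> borel_measurable (lebesgue_on {0<..<l})"
    by (intro continuous_imp_measurable_on_sets_lebesgue continuous_on_subset [OF assms]) auto
  have "bounded (f ` {0..l})"
    using assms compact_continuous_image compact_imp_bounded by blast
  then obtain B where B: "\<And>x. x \<in> {0..l} \<Longrightarrow> cmod (f x) \<le> B"
    by (meson bounded_iff imageI)
  have "(cmod (f x))\<^sup>2 \<le> B\<^sup>2" if "x \<in> {0<..<l}" for x
    using B[of x] that by (intro power_mono) auto
  then have "integrable (lebesgue_on {0<..<l}) (\<lambda>x. (cmod (f x))\<^sup>2)"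
    using meas by (intro integrable_const_bound [where B = "B\<^sup>2"]) auto
  with meas show ?thesis by (simp add: L2_def)
qed

lemma L2_imp_integrable:
  assumes "u \<in> L2 l"
  shows "integrable (lebesgue_on {0<..<l}) u"
proof -
  interpret finite_measure "lebesgue_on {0<..<l}"
    by (rule finite_measure_lebesgue_on_interval)
  have 1: "u \<in> borel_measurable (lebesgue_on {0<..<l})"
    and 2: "integrable (lebesgue_on {0<..<l}) (\<lambda>x. (cmod (u x))\<^sup>2)"
    using assms by (auto simp: L2_def)
  \<comment> \<open>On a finite measure space the constant 1 is integrable, so
    \<open>1 + |u|^2\<close> is an integrable majorant of \<open>|u|\<close>.\<close>
  have "t \<le> 1 + t\<^sup>2" for t :: real
    using zero_le_power2[of "t - 1/2"] by (simp add: power2_diff power_divide algebra_simps)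
  then have "norm (u x) \<le> norm (1 + (cmod (u x))\<^sup>2)" for x
    by simp
  then show ?thesis
    by (intro Bochner_Integration.integrable_bound [OF _ 1, where f = "\<lambda>x. 1 + (cmod (u x))\<^sup>2"])
       (use 2 in auto)
qed

lemma L2_mult_continuous:
  assumes "u \<in> L2 l" "continuous_on {0..l} c"
  shows "(\<lambda>x. c x * u x) \<in> L2 l"
proof -
  have meas: "c \<in> borel_measurable (lebesgue_on {0<..<l})"
    by (intro continuous_imp_measurable_on_sets_lebesgue continuous_on_subset [OF assms(2)]) auto
  have u: "u \<in> borel_measurable (lebesgue_on {0<..<l})"
    "integrable (lebesgue_on {0<..<l}) (\<lambda>x. (cmod (u x))\<^sup>2)"
    using assms by (auto simp: L2_def)
  have "bounded (c ` {0..l})"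
    using assms compact_continuous_image compact_imp_bounded by blast
  then obtain B where B: "\<And>x. x \<in> {0..l} \<Longrightarrow> cmod (c x) \<le> B"
    by (meson bounded_iff imageI)
  have "(cmod (c x * u x))\<^sup>2 \<le> B\<^sup>2 * (cmod (u x))\<^sup>2" if "x \<in> {0<..<l}" for x
    using B[of x] that by (simp add: norm_mult power_mult_distrib mult_right_mono power_mono)
  then have le: "AE x in lebesgue_on {0<..<l}.
      norm ((cmod (c x * u x))\<^sup>2) \<le> norm (B\<^sup>2 * (cmod (u x))\<^sup>2)"
    by (intro AE_I2) simp
  have "integrable (lebesgue_on {0<..<l}) (\<lambda>x. B\<^sup>2 * (cmod (u x))\<^sup>2)"
    using u(2) by (rule integrable_mult_right)
  moreover have "(\<lambda>x. (cmod (c x * u x))\<^sup>2) \<in> borel_measurable (lebesgue_on {0<..<l})"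
    using u(1) meas by measurable
  ultimately have "integrable (lebesgue_on {0<..<l}) (\<lambda>x. (cmod (c x * u x))\<^sup>2)"
    using le by (rule Bochner_Integration.integrable_bound)
  with u meas show ?thesis by (simp add: L2_def)
qed

lemma L2_cmult: "u \<in> L2 l \<Longrightarrow> (\<lambda>x. c * u x) \<in> L2 l"
  by (rule L2_mult_continuous) auto

lemma L2_add:
  assumes "u \<in> L2 l" "v \<in> L2 l"
  shows "(\<lambda>x. u x + v x) \<in> L2 l"
proof -
  have u: "u \<in> borel_measurable (lebesgue_on {0<..<l})"
    "integrable (lebesgue_on {0<..<l}) (\<lambda>x. (cmod (u x))\<^sup>2)"
    and v: "v \<in> borel_measurable (lebesgue_on {0<..<l})"
    "integrable (lebesgue_on {0<..<l}) (\<lambda>x. (cmod (v x))\<^sup>2)"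
    using assms by (auto simp: L2_def)
  have "(cmod (u x + v x))\<^sup>2 \<le> 2 * (cmod (u x))\<^sup>2 + 2 * (cmod (v x))\<^sup>2" for x
  proof -
    have "(cmod (u x + v x))\<^sup>2 \<le> (cmod (u x) + cmod (v x))\<^sup>2"
      by (intro power_mono norm_triangle_ineq) auto
    also have "\<dots> \<le> 2 * (cmod (u x))\<^sup>2 + 2 * (cmod (v x))\<^sup>2"
      using sum_squares_bound[of "cmod (u x)" "cmod (v x)"] by (simp add: power2_sum)
    finally show ?thesis .
  qed
  then have le: "AE x in lebesgue_on {0<..<l}.
      norm ((cmod (u x + v x))\<^sup>2) \<le> norm (2 * (cmod (u x))\<^sup>2 + 2 * (cmod (v x))\<^sup>2)"
    by (intro AE_I2) simp
  have "integrable (lebesgue_on {0<..<l}) (\<lambda>x. 2 * (cmod (u x))\<^sup>2 + 2 * (cmod (v x))\<^sup>2)"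
    using u(2) v(2) by (intro Bochner_Integration.integrable_add integrable_mult_right)
  moreover have "(\<lambda>x. (cmod (u x + v x))\<^sup>2) \<in> borel_measurable (lebesgue_on {0<..<l})"
    using u(1) v(1) by measurable
  ultimately have "integrable (lebesgue_on {0<..<l}) (\<lambda>x. (cmod (u x + v x))\<^sup>2)"
    using le by (rule Bochner_Integration.integrable_bound)
  with u v show ?thesis by (simp add: L2_def)
qed

lemma L2_diff: "u \<in> L2 l \<Longrightarrow> v \<in> L2 l \<Longrightarrow> (\<lambda>x. u x - v x) \<in> L2 l"
  using L2_add[of u l "\<lambda>x. (-1) * v x"] L2_cmult[of v l "-1"] by simp

lemma integrable_L2_mult_continuous:
  assumes "u \<in> L2 l" "continuous_on {0..l} c"
  shows "integrable (lebesgue_on {0<..<l}) (\<lambda>x. u x * c x)"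
  using L2_imp_integrable[OF L2_mult_continuous[OF assms]] by (simp add: mult.commute)


subsection \<open>The fundamental lemma of the calculus of variations\<close>

text \<open>Lebesgue differentiation: outside a null set the value at \<open>x\<close> is the limit
  of the averages over \<open>{x..x+h}\<close>, and for small \<open>h\<close> these averages vanish
  by hypothesis.\<close>

lemma AE_eq_0_if_interval_integrals_0:
  fixes g :: "real \<Rightarrow> complex"
  assumes g: "integrable (lebesgue_on {0<..<l}) g"
    and zero: "\<And>a b. 0 < a \<Longrightarrow> a < b \<Longrightarrow> b < l \<Longrightarrow> integral {a..b} g = 0"
  shows "AE x in lebesgue_on {0<..<l}. g x = 0"
proof -
  \<comment> \<open>Extension by zero gives a function integrable on every box of the line, as the
    differentiation theorem requires.\<close>
  define f where "f = (\<lambda>x. if x \<in> {0<..<l} then g x else 0)"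
  have "g integrable_on {0<..<l}"
    using g by (intro integrable_on_lebesgue_on) auto
  then have "f integrable_on UNIV"
    unfolding f_def by (simp only: integrable_restrict_UNIV)
  then have "f integrable_on cbox a b" for a b
    by (rule integrable_on_subcbox) auto
  then obtain N where N: "negligible N"
    "\<And>x e. \<lbrakk>x \<notin> N; 0 < e\<rbrakk> \<Longrightarrow> \<exists>d>0. \<forall>h. 0 < h \<and> h < d \<longrightarrow>
        norm (integral (cbox x (x + h *\<^sub>R One)) f /\<^sub>R h ^ DIM(real) - f x) < e"
    using integrable_ccontinuous_explicit[of f] by blast
  have "g x = 0" if x: "x \<in> {0<..<l}" "x \<notin> N" for x
  proof (rule ccontr)
    assume "g x \<noteq> 0"
    then obtain d where d: "d > 0" "\<And>h. 0 < h \<Longrightarrow> h < d \<Longrightarrow>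
        norm (integral (cbox x (x + h *\<^sub>R One)) f /\<^sub>R h ^ DIM(real) - f x) < norm (g x)"
      using N(2)[OF x(2), of "norm (g x)"] by auto
    \<comment> \<open>Halving makes \<open>h\<close> strictly smaller than \<open>d\<close> and
      keeps \<open>{x..x+h}\<close> inside the open interval.\<close>
    define h where "h = min d (l - x) / 2"
    have h: "0 < h" "h < d" "x + h < l"
      using d x by (auto simp: h_def min_def field_simps)
    have "integral (cbox x (x + h *\<^sub>R One)) f = integral {x..x+h} g"
      using x h by (auto simp: f_def intro!: integral_cong)
    also have "\<dots> = 0" using x h by (intro zero) auto
    finally show False using d(2)[OF h(1,2)] x by (simp add: f_def)
  qed
  then have "AE x in lebesgue. x \<in> {0<..<l} \<longrightarrow> g x = 0"
    using N(1) by (intro AE_I'[of N]) (auto simp: negligible_iff_null_sets)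
  then show ?thesis by (subst AE_restrict_space_iff) auto
qed

section \<open>Cut-off functions approximating indicators of intervals\<close>

lemma has_real_derivative_max_square:
  "((\<lambda>y::real. (max 0 y)\<^sup>2) has_real_derivative 2 * max 0 y) (at y)"
proof -
  consider "y < 0" | "y > 0" | "y = 0" by linarith
  then show ?thesis
  proof cases
    case 1
    have "((\<lambda>y::real. 0) has_real_derivative 2 * max 0 y) (at y)"
      using 1 by auto
    then show ?thesis
      by (rule has_field_derivative_transform_within_open[where S = "{..<0}"]) (use 1 in auto)
  next
    case 2
    have "((\<lambda>y::real. y\<^sup>2) has_real_derivative 2 * max 0 y) (at y)"
      by (rule derivative_eq_intros refl | use 2 in simp)+
    then show ?thesis
      by (rule has_field_derivative_transform_within_open[where S = "{0<..}"]) (use 2 in auto)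
  next
    case 3
    \<comment> \<open>At the kink the difference quotient is bounded by \<open>|h|\<close>, so
      squaring the positive part removes the corner.\<close>
    have "((\<lambda>h::real. (max 0 h)\<^sup>2 / h) \<longlongrightarrow> 0) (at 0)"
    proof (rule Lim_null_comparison)
      show "\<forall>\<^sub>F h::real in at 0. norm ((max 0 h)\<^sup>2 / h) \<le> \<bar>h\<bar>"
        by (intro always_eventually allI) (auto simp: max_def power2_eq_square)
      show "((\<lambda>h::real. \<bar>h\<bar>) \<longlongrightarrow> 0) (at 0)"
        by (intro tendsto_eq_intros) auto
    qed
    then show ?thesis using 3 by (simp add: DERIV_def)
  qed
qed

text \<open>For \<open>a < b\<close> the positive part of \<open>(x - a) * (b - x)\<close> lives
  exactly on the open interval from \<open>a\<close> to \<open>b\<close>; its square is C^1. In the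
  form \<open>m^2 / (m^2 + 1/(n+1))\<close> it increases to 1 wherever \<open>m > 0\<close> and
  stays 0 elsewhere, while the denominator never vanishes.\<close>

definition bump :: "real \<Rightarrow> real \<Rightarrow> nat \<Rightarrow> real \<Rightarrow> real" where
  "bump a b n x = (max 0 ((x - a) * (b - x)))\<^sup>2 / ((max 0 ((x - a) * (b - x)))\<^sup>2 + 1 / Suc n)"

lemma bump_bounds: "0 \<le> bump a b n x" "bump a b n x \<le> 1"
  by (simp_all add: bump_def divide_le_eq_1 zero_less_divide_iff less_le add_nonneg_nonneg)

lemma bump_eq_0: "a < b \<Longrightarrow> x \<notin> {a<..<b} \<Longrightarrow> bump a b n x = 0"
  by (auto simp: bump_def max_def mult_le_0_iff zero_le_mult_iff not_less)

lemma bump_tendsto: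
  assumes "a < b"
  shows "(\<lambda>n. bump a b n x) \<longlonglongrightarrow> indicator {a<..<b} x"
proof (cases "x \<in> {a<..<b}")
  case True
  define c where "c = (max 0 ((x - a) * (b - x)))\<^sup>2"
  have "c \<noteq> 0" using True by (auto simp: c_def max_def mult_le_0_iff)
  moreover have "(\<lambda>n. 1 / real (Suc n)) \<longlonglongrightarrow> 0"
    using LIMSEQ_inverse_real_of_nat by (simp add: inverse_eq_divide)
  ultimately have "(\<lambda>n. c / (c + 1 / real (Suc n))) \<longlonglongrightarrow> c / (c + 0)"
    by (intro tendsto_intros) auto
  then show ?thesis using \<open>c \<noteq> 0\<close> True by (simp add: bump_def c_def)
next
  case False
  then show ?thesis using bump_eq_0[OF assms False] by simp
qed

lemma bump_test_function:
  assumes "0 < a" "a < b" "b < l"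
  shows "(\<lambda>x. of_real (bump a b n x)) \<in> test_functions l"
proof -
  define m where "m = (\<lambda>x. max 0 ((x - a) * (b - x)))"
  define m' where "m' = (\<lambda>x. 2 * m x * (a + b - 2 * x))"
  have m: "((\<lambda>x. (m x)\<^sup>2) has_real_derivative m' x) (at x)" for x
  proof -
    have "((\<lambda>x. (x - a) * (b - x)) has_real_derivative (a + b - 2 * x)) (at x)"
      by (rule derivative_eq_intros refl | simp)+
    from DERIV_chain2[OF has_real_derivative_max_square this]
    show ?thesis by (simp add: m_def m'_def)
  qed
  have pos: "(m x)\<^sup>2 + 1 / real (Suc n) > 0" for x
    by (intro add_nonneg_pos) auto
  define D where "D = (\<lambda>x. (m' x * ((m x)\<^sup>2 + 1 / real (Suc n)) - (m x)\<^sup>2 * m' x) /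
      (((m x)\<^sup>2 + 1 / real (Suc n)) * ((m x)\<^sup>2 + 1 / real (Suc n))))"
  have "((\<lambda>x. (m x)\<^sup>2 / ((m x)\<^sup>2 + 1 / real (Suc n))) has_real_derivative D x) (at x)" for x
    using pos[of x] unfolding D_def
    by (intro DERIV_divide m) (use DERIV_add[OF m[of x] DERIV_const[of "1 / real (Suc n)"]] in auto)
  then have "((\<lambda>x. of_real (bump a b n x) :: complex) has_vector_derivative of_real (D x)) (at x)" for x
    unfolding bump_def m_def
    by (intro has_vector_derivative_of_real)
       (simp add: has_real_derivative_iff_has_vector_derivative)
  moreover have "continuous_on UNIV (\<lambda>x. of_real (D x) :: complex)"
    unfolding D_def m'_def m_def
    by (intro continuous_intros) (use pos in \<open>auto simp: m_def less_le\<close>)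
  ultimately have C1: "(\<lambda>x. of_real (bump a b n x) :: complex) C1_differentiable_on UNIV"
    unfolding C1_differentiable_on_def by (intro exI[of _ "\<lambda>x. of_real (D x)"]) auto
  have "closure {x. complex_of_real (bump a b n x) \<noteq> 0} \<subseteq> {a..b}"
  proof (rule closure_minimal)
    show "{x. complex_of_real (bump a b n x) \<noteq> 0} \<subseteq> {a..b}"
    proof
      fix x assume "x \<in> {x. complex_of_real (bump a b n x) \<noteq> 0}"
      then show "x \<in> {a..b}" using bump_eq_0[OF assms(2), of x n] by force
    qed
  qed auto
  also have "\<dots> \<subseteq> {0<..<l}" using assms by auto
  finally show ?thesis using C1 by (simp add: test_functions_def)
qed

text \<open>The bumps are test functions bounded by 1 that converge to the indicator of an interval.
  Dominated convergence with majorant \<open>|g|\<close> turns the hypothesis into vanishing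
  integrals over all compact subintervals.\<close>

lemma fundamental_lemma:
  assumes g: "integrable (lebesgue_on {0<..<l}) g"
    and zero: "\<And>\<phi>. \<phi> \<in> test_functions l \<Longrightarrow> (LINT x|lebesgue_on {0<..<l}. g x * \<phi> x) = 0"
  shows "AE x in lebesgue_on {0<..<l}. g x = 0"
proof (rule AE_eq_0_if_interval_integrals_0[OF g])
  fix a b :: real assume ab: "0 < a" "a < b" "b < l"
  have bm: "(\<lambda>x. complex_of_real (bump a b n x)) \<in> borel_measurable (lebesgue_on {0<..<l})" for n
  proof (rule continuous_imp_measurable_on_sets_lebesgue)
    have "(\<lambda>x. complex_of_real (bump a b n x)) C1_differentiable_on UNIV"
      using bump_test_function[OF ab] by (simp add: test_functions_def)
    then show "continuous_on {0<..<l} (\<lambda>x. complex_of_real (bump a b n x))"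
      using C1_differentiable_imp_continuous_on continuous_on_subset by blast
  qed auto
  have ind: "(\<lambda>x. indicator {a<..<b} x :: real) \<in> borel_measurable (lebesgue_on {0<..<l})"
    using ab by (intro borel_measurable_indicator) (auto simp: sets_restrict_space_iff)
  have "(\<lambda>n. LINT x|lebesgue_on {0<..<l}. g x * of_real (bump a b n x))
      \<longlonglongrightarrow> (LINT x|lebesgue_on {0<..<l}. g x * of_real (indicator {a<..<b} x))"
  proof (rule integral_dominated_convergence[where w = "\<lambda>x. norm (g x)"])
    show "AE x in lebesgue_on {0<..<l}. (\<lambda>n. g x * of_real (bump a b n x))
        \<longlonglongrightarrow> g x * of_real (indicator {a<..<b} x)"
      by (intro AE_I2 tendsto_mult tendsto_of_real bump_tendsto tendsto_const ab)
    show "AE x in lebesgue_on {0<..<l}. norm (g x * of_real (bump a b n x)) \<le> norm (g x)" for n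
      using bump_bounds by (intro AE_I2) (auto simp: norm_mult intro!: mult_right_le_one_le)
  qed (use g bm ind in auto)
  moreover have "(LINT x|lebesgue_on {0<..<l}. g x * of_real (bump a b n x)) = 0" for n
    by (intro zero bump_test_function ab)
  ultimately have "(LINT x|lebesgue_on {0<..<l}. g x * of_real (indicator {a<..<b} x)) = 0"
    using LIMSEQ_unique[OF tendsto_const] by fastforce
  moreover have "integrable (lebesgue_on {0<..<l}) (\<lambda>x. g x * of_real (indicator {a<..<b} x))"
    using ind by (intro Bochner_Integration.integrable_bound[OF g])
      (use g in \<open>auto simp: norm_mult indicator_def\<close>)
  ultimately have "integral {0<..<l} (\<lambda>x. g x * of_real (indicator {a<..<b} x)) = 0"
    by (subst lebesgue_integral_eq_integral[symmetric]) auto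
  moreover have "(\<lambda>x. if x \<in> {0<..<l} then g x * of_real (indicator {a<..<b} x) else 0)
      = (\<lambda>x. if x \<in> {a<..<b} then g x else 0)"
    using ab by (auto simp: fun_eq_iff indicator_def)
  ultimately have "integral {a<..<b} g = 0"
    by (subst (asm) integral_restrict_UNIV[symmetric], subst integral_restrict_UNIV[symmetric]) simp
  then show "integral {a..b} g = 0"
    by (simp add: integral_open_interval_real)
qed


subsection \<open>Weak derivatives\<close>

lemma test_functionE:
  assumes "\<phi> \<in> test_functions l"
  obtains \<phi>' where "\<And>x. (\<phi> has_vector_derivative \<phi>' x) (at x)" "continuous_on UNIV \<phi>'"
    "\<And>x. vector_derivative \<phi> (at x) = \<phi>' x" "continuous_on UNIV \<phi>"
    "\<And>x. x \<notin> {0<..<l} \<Longrightarrow> \<phi> x = 0"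
proof -
  have C1: "\<phi> C1_differentiable_on UNIV" and supp: "closure {x. \<phi> x \<noteq> 0} \<subseteq> {0<..<l}"
    using assms by (auto simp: test_functions_def)
  from C1 obtain \<phi>' where *: "\<And>x. (\<phi> has_vector_derivative \<phi>' x) (at x)" "continuous_on UNIV \<phi>'"
    by (auto simp: C1_differentiable_on_def)
  have "\<phi> x = 0" if "x \<notin> {0<..<l}" for x
    using supp closure_subset[of "{x. \<phi> x \<noteq> 0}"] that by blast
  with * show thesis
    using that C1_differentiable_imp_continuous_on[OF C1] vector_derivative_at by metis
qed

lemma test_function_L2:
  assumes "\<phi> \<in> test_functions l"
  shows "\<phi> \<in> L2 l" "(\<lambda>x. vector_derivative \<phi> (at x)) \<in> L2 l"
proof -
  obtain \<phi>' where *: "continuous_on UNIV \<phi>'" "\<And>x. vector_derivative \<phi> (at x) = \<phi>' x"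
    "continuous_on UNIV \<phi>"
    using test_functionE[OF assms] by metis
  then have "(\<lambda>x. vector_derivative \<phi> (at x)) = \<phi>'" by auto
  with * show "\<phi> \<in> L2 l" "(\<lambda>x. vector_derivative \<phi> (at x)) \<in> L2 l"
    by (metis continuous_imp_L2 continuous_on_subset subset_UNIV)+
qed

lemma integrable_mult_test_function:
  assumes "u \<in> L2 l" "\<phi> \<in> test_functions l"
  shows "integrable (lebesgue_on {0<..<l}) (\<lambda>x. u x * \<phi> x)"
    "integrable (lebesgue_on {0<..<l}) (\<lambda>x. u x * vector_derivative \<phi> (at x))"
proof -
  obtain \<phi>' where *: "continuous_on UNIV \<phi>'" "\<And>x. vector_derivative \<phi> (at x) = \<phi>' x"
    "continuous_on UNIV \<phi>"
    using test_functionE[OF assms(2)] by metis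
  show "integrable (lebesgue_on {0<..<l}) (\<lambda>x. u x * \<phi> x)"
    by (intro integrable_L2_mult_continuous assms continuous_on_subset[OF *(3)]) auto
  show "integrable (lebesgue_on {0<..<l}) (\<lambda>x. u x * vector_derivative \<phi> (at x))"
    unfolding *(2)
    by (intro integrable_L2_mult_continuous assms continuous_on_subset[OF *(1)]) auto
qed

lemma test_functionI:
  assumes "\<And>x. (\<phi> has_vector_derivative \<phi>' x) (at x)" "continuous_on UNIV \<phi>'"
    and "0 < c" "d < l" "\<And>x. x \<notin> {c..d} \<Longrightarrow> \<phi> x = 0"
  shows "\<phi> \<in> test_functions l"
proof -
  have "closure {x. \<phi> x \<noteq> 0} \<subseteq> {c..d}"
    by (rule closure_minimal) (use assms(5) in force)+
  also have "\<dots> \<subseteq> {0<..<l}" using assms by auto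
  finally show ?thesis
    using assms(1,2) by (auto simp: test_functions_def C1_differentiable_on_def)
qed

lemma test_function_support:
  assumes "\<phi> \<in> test_functions l" "0 < l"
  obtains c d where "0 < c" "d < l" "c < d" "\<And>x. x \<notin> {c..d} \<Longrightarrow> \<phi> x = 0"
proof -
  \<comment> \<open>The midpoint is inserted so that \<open>K\<close> is nonempty even when
    \<open>\<phi>\<close> vanishes identically, and the extrema exist.\<close>
  define K where "K = insert (l/2) (closure {x. \<phi> x \<noteq> 0})"
  have K: "K \<subseteq> {0<..<l}" using assms by (auto simp: K_def test_functions_def)
  then have "bounded K" using bounded_subset[of "{0<..<l}" K] by simp
  then have "compact K" by (simp add: compact_eq_bounded_closed K_def)
  moreover have "K \<noteq> {}" by (simp add: K_def)
  ultimately obtain c d where c: "c \<in> K" "\<And>x. x \<in> K \<Longrightarrow> c \<le> x"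
    and d: "d \<in> K" "\<And>x. x \<in> K \<Longrightarrow> x \<le> d"
    using compact_attains_inf[of K] compact_attains_sup[of K] by metis
  show thesis
  proof
    \<comment> \<open>Moving the extrema halfway towards 0 and \<open>l\<close> makes the inequality
      between them strict even if \<open>K\<close> is a single point.\<close>
    show "0 < c / 2" "(d + l) / 2 < l" "c / 2 < (d + l) / 2"
      using c(1) d(1) d(2)[OF c(1)] K by (auto simp: subset_iff)
    fix x assume x: "x \<notin> {c / 2..(d + l) / 2}"
    have "x \<notin> K"
    proof
      assume "x \<in> K"
      then have "c \<le> x" "x \<le> d" "0 < c" "d < l" using c d K by auto
      with x show False by auto
    qed
    then show "\<phi> x = 0" using closure_subset[of "{x. \<phi> x \<noteq> 0}"] by (auto simp: K_def)
  qed
qed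

lemma test_function_mult:
  assumes "\<phi> \<in> test_functions l" "0 < l"
    and \<psi>: "\<And>x. (\<psi> has_vector_derivative \<psi>' x) (at x)" "continuous_on UNIV \<psi>'"
  shows "(\<lambda>x. \<psi> x * \<phi> x) \<in> test_functions l"
proof -
  obtain \<phi>' where *: "\<And>x. (\<phi> has_vector_derivative \<phi>' x) (at x)" "continuous_on UNIV \<phi>'"
    "continuous_on UNIV \<phi>"
    using test_functionE[OF assms(1)] by metis
  obtain c d where cd: "0 < c" "d < l" "\<And>x. x \<notin> {c..d} \<Longrightarrow> \<phi> x = 0"
    using test_function_support[OF assms(1,2)] by metis
  have "continuous_on UNIV \<psi>"
    using \<psi>(1) has_vector_derivative_continuous by (metis continuous_at_imp_continuous_on)
  then have "continuous_on UNIV (\<lambda>x. \<psi> x * \<phi>' x + \<psi>' x * \<phi> x)"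
    using * \<psi>(2) by (intro continuous_intros)
  with cd show ?thesis
    by (intro test_functionI[where \<phi>' = "\<lambda>x. \<psi> x * \<phi>' x + \<psi>' x * \<phi> x" and c = c and d = d]
        has_vector_derivative_mult * \<psi>) auto
qed

section \<open>Calculus of weak derivatives\<close>

lemma is_weak_deriv_add:
  assumes "is_weak_deriv l u g" "is_weak_deriv l v h" "u \<in> L2 l" "v \<in> L2 l" "g \<in> L2 l" "h \<in> L2 l"
  shows "is_weak_deriv l (\<lambda>x. u x + v x) (\<lambda>x. g x + h x)"
  using assms by (simp add: is_weak_deriv_def distrib_right integrable_mult_test_function)

lemma is_weak_deriv_cmult:
  assumes "is_weak_deriv l u g"
  shows "is_weak_deriv l (\<lambda>x. c * u x) (\<lambda>x. c * g x)"
  using assms by (simp add: is_weak_deriv_def mult.assoc)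

lemma is_weak_deriv_cong_AE:
  assumes "is_weak_deriv l u g" "u \<in> L2 l" "v \<in> L2 l" "g \<in> L2 l" "h \<in> L2 l"
    and uv: "AE x in lebesgue_on {0<..<l}. u x = v x" and gh: "AE x in lebesgue_on {0<..<l}. g x = h x"
  shows "is_weak_deriv l v h"
  unfolding is_weak_deriv_def
proof
  fix \<phi> assume \<phi>: "\<phi> \<in> test_functions l"
  note int = integrable_mult_test_function[OF _ \<phi>, THEN borel_measurable_integrable]
  have "(LINT x|lebesgue_on {0<..<l}. v x * vector_derivative \<phi> (at x))
      = (LINT x|lebesgue_on {0<..<l}. u x * vector_derivative \<phi> (at x))"
    by (rule integral_cong_AE) (use assms int uv in auto)
  also have "\<dots> = - (LINT x|lebesgue_on {0<..<l}. g x * \<phi> x)"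
    using assms(1) \<phi> by (simp add: is_weak_deriv_def)
  also have "(LINT x|lebesgue_on {0<..<l}. g x * \<phi> x) = (LINT x|lebesgue_on {0<..<l}. h x * \<phi> x)"
    by (rule integral_cong_AE) (use assms int gh in auto)
  finally show "(LINT x|lebesgue_on {0<..<l}. v x * vector_derivative \<phi> (at x))
      = - (LINT x|lebesgue_on {0<..<l}. h x * \<phi> x)" .
qed

text \<open>Product rule with a C^1 factor: \<open>\<psi> * \<phi>\<close> is again a test function,
  so the weak derivative of \<open>u\<close> may be tested against it, and expanding its derivative
  gives the claim.\<close>

lemma is_weak_deriv_mult:
  assumes ug: "is_weak_deriv l u g" and u: "u \<in> L2 l" and g: "g \<in> L2 l" and "0 < l"
    and \<psi>: "\<And>x. (\<psi> has_vector_derivative \<psi>' x) (at x)" "continuous_on UNIV \<psi>'"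
  shows "is_weak_deriv l (\<lambda>x. \<psi> x * u x) (\<lambda>x. \<psi> x * g x + \<psi>' x * u x)"
  unfolding is_weak_deriv_def
proof
  fix \<phi> assume \<phi>: "\<phi> \<in> test_functions l"
  have cont: "continuous_on {0..l} \<psi>" "continuous_on {0..l} \<psi>'"
    using \<psi> has_vector_derivative_continuous
    by (meson continuous_at_imp_continuous_on continuous_on_subset subset_UNIV)+
  have \<psi>\<phi>: "(\<lambda>x. \<psi> x * \<phi> x) \<in> test_functions l"
    by (rule test_function_mult[OF \<phi> \<open>0 < l\<close> \<psi>])
  obtain \<phi>' where \<phi>': "\<And>x. (\<phi> has_vector_derivative \<phi>' x) (at x)"
    "\<And>x. vector_derivative \<phi> (at x) = \<phi>' x"
    using test_functionE[OF \<phi>] by metis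
  have deriv: "vector_derivative (\<lambda>x. \<psi> x * \<phi> x) (at x) = \<psi> x * \<phi>' x + \<psi>' x * \<phi> x" for x
    by (intro vector_derivative_at has_vector_derivative_mult \<phi>' \<psi>)
  have \<psi>u: "(\<lambda>x. \<psi> x * u x) \<in> L2 l" "(\<lambda>x. \<psi>' x * u x) \<in> L2 l" "(\<lambda>x. \<psi> x * g x) \<in> L2 l"
    by (intro L2_mult_continuous u g cont)+
  note int = integrable_mult_test_function[OF _ \<phi>]
  have "(LINT x|lebesgue_on {0<..<l}. u x * vector_derivative (\<lambda>x. \<psi> x * \<phi> x) (at x))
      = - (LINT x|lebesgue_on {0<..<l}. g x * (\<psi> x * \<phi> x))"
    using ug \<psi>\<phi> by (simp add: is_weak_deriv_def)
  moreover have "(LINT x|lebesgue_on {0<..<l}. u x * vector_derivative (\<lambda>x. \<psi> x * \<phi> x) (at x))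
      = (LINT x|lebesgue_on {0<..<l}. (\<psi> x * u x) * vector_derivative \<phi> (at x) + (\<psi>' x * u x) * \<phi> x)"
    unfolding deriv \<phi>'(2) by (simp add: algebra_simps)
  moreover have "\<dots> = (LINT x|lebesgue_on {0<..<l}. (\<psi> x * u x) * vector_derivative \<phi> (at x))
      + (LINT x|lebesgue_on {0<..<l}. (\<psi>' x * u x) * \<phi> x)"
    by (intro Bochner_Integration.integral_add int \<psi>u)
  moreover have "(LINT x|lebesgue_on {0<..<l}. (\<psi> x * g x + \<psi>' x * u x) * \<phi> x)
      = (LINT x|lebesgue_on {0<..<l}. g x * (\<psi> x * \<phi> x))
      + (LINT x|lebesgue_on {0<..<l}. (\<psi>' x * u x) * \<phi> x)"
    using int[OF \<psi>u(3)] int[OF \<psi>u(2)]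
    by (simp add: distrib_right Bochner_Integration.integral_add[symmetric] algebra_simps
        del: Bochner_Integration.integral_add)
  \<comment> \<open>Pure arithmetic that combines the four identities between integrals
    above.\<close>
  moreover have "p = - r" if "a = - b" "a = y" "y = p + q" "r = b + q" for a b p q r y :: complex
    using that by (simp add: algebra_simps)
  ultimately show "(LINT x|lebesgue_on {0<..<l}. \<psi> x * u x * vector_derivative \<phi> (at x))
      = - (LINT x|lebesgue_on {0<..<l}. (\<psi> x * g x + \<psi>' x * u x) * \<phi> x)"
    by blast
qed

text \<open>Integration by parts: the fundamental theorem of calculus is applied to
  \<open>U * \<phi>\<close>, whose boundary terms vanish because \<open>\<phi>\<close> is zero at 0
  and at \<open>l\<close>.\<close>

lemma is_weak_deriv_C1:
  assumes "0 < l" and U: "\<And>x. (U has_vector_derivative U' x) (at x)" "continuous_on UNIV U'"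
  shows "is_weak_deriv l U U'"
  unfolding is_weak_deriv_def
proof
  fix \<phi> assume \<phi>: "\<phi> \<in> test_functions l"
  have cont: "continuous_on {0..l} U" "continuous_on {0..l} U'"
    using U has_vector_derivative_continuous
    by (meson continuous_at_imp_continuous_on continuous_on_subset subset_UNIV)+
  obtain \<phi>' where \<phi>': "\<And>x. (\<phi> has_vector_derivative \<phi>' x) (at x)"
    "\<And>x. vector_derivative \<phi> (at x) = \<phi>' x" "\<And>x. x \<notin> {0<..<l} \<Longrightarrow> \<phi> x = 0"
    using test_functionE[OF \<phi>] by metis
  have int: "integrable (lebesgue_on {0<..<l}) (\<lambda>x. U x * vector_derivative \<phi> (at x))"
    "integrable (lebesgue_on {0<..<l}) (\<lambda>x. U' x * \<phi> x)"
    by (intro integrable_mult_test_function continuous_imp_L2 cont \<phi>)+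
  have "((\<lambda>x. U x * \<phi>' x + U' x * \<phi> x) has_integral U l * \<phi> l - U 0 * \<phi> 0) {0..l}"
    using \<open>0 < l\<close>
    by (intro fundamental_theorem_of_calculus has_vector_derivative_mult)
       (auto intro: has_vector_derivative_at_within \<phi>' U)
  then have "((\<lambda>x. U x * \<phi>' x + U' x * \<phi> x) has_integral 0) {0<..<l}"
    by (simp add: has_integral_Icc_iff_Ioo \<phi>'(3))
  moreover have "((\<lambda>x. U x * \<phi>' x + U' x * \<phi> x) has_integral
      (LINT x|lebesgue_on {0<..<l}. U x * \<phi>' x + U' x * \<phi> x)) {0<..<l}"
    using int \<phi>'(2) by (intro has_integral_integral_lebesgue_on) auto
  ultimately have "(LINT x|lebesgue_on {0<..<l}. U x * \<phi>' x + U' x * \<phi> x) = 0"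
    using has_integral_unique by blast
  then show "(LINT x|lebesgue_on {0<..<l}. U x * vector_derivative \<phi> (at x))
      = - (LINT x|lebesgue_on {0<..<l}. U' x * \<phi> x)"
    using int by (simp add: \<phi>'(2) eq_neg_iff_add_eq_0)
qed

lemma weak_deriv_unique:
  assumes "is_weak_deriv l u g" "is_weak_deriv l u h" "g \<in> L2 l" "h \<in> L2 l"
  shows "AE x in lebesgue_on {0<..<l}. g x = h x"
proof -
  have "AE x in lebesgue_on {0<..<l}. g x - h x = 0"
  proof (rule fundamental_lemma)
    show "integrable (lebesgue_on {0<..<l}) (\<lambda>x. g x - h x)"
      by (intro L2_imp_integrable L2_diff assms)
    fix \<phi> assume \<phi>: "\<phi> \<in> test_functions l"
    then have "(LINT x|lebesgue_on {0<..<l}. g x * \<phi> x) = (LINT x|lebesgue_on {0<..<l}. h x * \<phi> x)"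
      using assms(1,2) by (simp add: is_weak_deriv_def)
    then show "(LINT x|lebesgue_on {0<..<l}. (g x - h x) * \<phi> x) = 0"
      using \<phi> assms by (simp add: left_diff_distrib integrable_mult_test_function)
  qed
  then show ?thesis by simp
qed

section \<open>Functions with vanishing weak derivative\<close>

lemma not_AE_False_interval:
  assumes "0 < (l::real)"
  shows "\<not> (AE x in lebesgue_on {0<..<l}. False)"
proof -
  have "emeasure (lebesgue_on {0<..<l}) (space (lebesgue_on {0<..<l})) \<noteq> 0"
    using assms by (simp add: emeasure_restrict_space)
  then show ?thesis by (metis ae_filter_eq_bot_iff trivial_limit_def eventually_False)
qed

text \<open>The antiderivative that starts left of the support is zero there; right of the support
  it equals the total integral, which is zero by assumption. Hence it has compact support
  again.\<close>

lemma test_function_antiderivative: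
  assumes \<rho>: "\<rho> \<in> test_functions l" and "0 < l"
    and mean: "(LINT x|lebesgue_on {0<..<l}. \<rho> x) = 0"
  obtains \<phi> where "\<phi> \<in> test_functions l" "\<And>x. vector_derivative \<phi> (at x) = \<rho> x"
proof -
  obtain c d where cd: "0 < c" "d < l" "c < d" "\<And>x. x \<notin> {c..d} \<Longrightarrow> \<rho> x = 0"
    using test_function_support[OF \<rho> \<open>0 < l\<close>] by metis
  have cont: "continuous_on UNIV \<rho>" using \<rho> by (rule test_functionE)
  \<comment> \<open>The base point -1 lies left of the interval. Thus every \<open>x \<ge> c\<close>
    is interior to \<open>{-1..x+1}\<close>, where the fundamental theorem applies; for
    \<open>x < c\<close> the function is locally zero.\<close>
  define \<phi> where "\<phi> = (\<lambda>x. integral {-1..x} \<rho>)"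
  have left: "\<phi> x = 0" if "x < c" for x
    unfolding \<phi>_def by (rule integral_unique, rule has_integral_is_0) (use that cd in auto)
  have right: "\<phi> x = 0" if "x > d" for x
  proof -
    have "integral {-1..x} \<rho> = integral {0<..<l} \<rho>"
    proof (subst (1 2) integral_restrict_UNIV[symmetric], rule arg_cong[of _ _ "integral UNIV"])
      have "y \<in> {-1..x} \<inter> {0<..<l}" if "\<rho> y \<noteq> 0" for y
        using cd(4)[of y] that cd(1-3) \<open>x > d\<close> by force
      then show "(\<lambda>y. if y \<in> {-1..x} then \<rho> y else 0) = (\<lambda>y. if y \<in> {0<..<l} then \<rho> y else 0)"
        by (auto simp: fun_eq_iff)
    qed
    also have "\<dots> = (LINT x|lebesgue_on {0<..<l}. \<rho> x)"
      by (rule lebesgue_integral_eq_integral[symmetric])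
         (auto intro: L2_imp_integrable test_function_L2 \<rho>)
    finally show ?thesis using mean by (simp add: \<phi>_def)
  qed
  have deriv: "(\<phi> has_vector_derivative \<rho> x) (at x)" for x
  proof (cases "x < c")
    case True
    have "((\<lambda>x. 0) has_vector_derivative \<rho> x) (at x)"
      using cd(4)[of x] True by simp
    then show ?thesis
      by (rule has_vector_derivative_transform_within_open[of _ _ _ "{..<c}"]) (use True left in auto)
  next
    case False
    have "(\<phi> has_vector_derivative \<rho> x) (at x within {-1..x+1})"
      unfolding \<phi>_def
      by (rule integral_has_vector_derivative) (use False cd cont in \<open>auto intro: continuous_on_subset\<close>)
    moreover have "at x within {-1..x+1} = at x"
      using False cd by (intro at_within_interior) auto
    ultimately show ?thesis by simp
  qed
  show thesis
  proof
    show "\<phi> \<in> test_functions l"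
      by (rule test_functionI[OF deriv cont cd(1,2)]) (use left right in force)
    show "vector_derivative \<phi> (at x) = \<rho> x" for x
      by (rule vector_derivative_at[OF deriv])
  qed
qed

lemma test_functions_add_cmult:
  assumes "\<phi> \<in> test_functions l" "\<psi> \<in> test_functions l"
  shows "(\<lambda>x. \<phi> x + k * \<psi> x) \<in> test_functions l"
proof -
  have "closure {x. \<phi> x + k * \<psi> x \<noteq> 0} \<subseteq> closure ({x. \<phi> x \<noteq> 0} \<union> {x. \<psi> x \<noteq> 0})"
    by (rule closure_mono) auto
  with assms show ?thesis
    by (auto simp: test_functions_def closure_Un)
qed

text \<open>Du Bois-Reymond argument: any test function, corrected by a multiple of a fixed
  \<open>\<eta>\<close> with nonzero integral, has mean zero and so is the derivative of a test
  function, against which \<open>u\<close> integrates to 0. This forces \<open>u\<close> to equal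
  its \<open>\<eta>\<close>-weighted mean.\<close>

lemma weak_deriv_0_imp_const:
  assumes "is_weak_deriv l u (\<lambda>x. 0)" and u: "u \<in> L2 l" and "0 < l"
  obtains m where "AE x in lebesgue_on {0<..<l}. u x = m"
proof -
  \<comment> \<open>If all test functions had integral zero, the fundamental lemma for the constant
    1 would give 1 = 0 almost everywhere on an interval of positive length.\<close>
  have "\<exists>\<eta>\<in>test_functions l. (LINT x|lebesgue_on {0<..<l}. \<eta> x) \<noteq> 0"
  proof (rule ccontr)
    assume "\<not> ?thesis"
    then have "AE x in lebesgue_on {0<..<l}. (1::complex) = 0"
      by (intro fundamental_lemma L2_imp_integrable continuous_imp_L2) auto
    with not_AE_False_interval[OF \<open>0 < l\<close>] show False by simp
  qed
  then obtain \<eta> where \<eta>: "\<eta> \<in> test_functions l" "(LINT x|lebesgue_on {0<..<l}. \<eta> x) \<noteq> 0"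
    by blast
  define N where "N = (LINT x|lebesgue_on {0<..<l}. \<eta> x)"
  define m where "m = (LINT x|lebesgue_on {0<..<l}. u x * \<eta> x) / N"
  have "AE x in lebesgue_on {0<..<l}. u x - m = 0"
  proof (rule fundamental_lemma)
    show "integrable (lebesgue_on {0<..<l}) (\<lambda>x. u x - m)"
      by (intro L2_imp_integrable L2_diff continuous_imp_L2 u) auto
    fix \<psi> assume \<psi>: "\<psi> \<in> test_functions l"
    define I where "I = (LINT x|lebesgue_on {0<..<l}. \<psi> x)"
    \<comment> \<open>The coefficient of \<open>\<eta>\<close> is the one that cancels the integral
      \<open>I\<close> of \<open>\<psi>\<close>.\<close>
    define \<rho> where "\<rho> = (\<lambda>x. \<psi> x + (- I / N) * \<eta> x)"
    have \<rho>: "\<rho> \<in> test_functions l"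
      unfolding \<rho>_def by (intro test_functions_add_cmult \<psi> \<eta>)
    have int: "integrable (lebesgue_on {0<..<l}) \<psi>" "integrable (lebesgue_on {0<..<l}) \<eta>"
      by (intro L2_imp_integrable test_function_L2 \<psi> \<eta>)+
    have "(LINT x|lebesgue_on {0<..<l}. \<rho> x) = I + (- I / N) * N"
      using int unfolding \<rho>_def I_def N_def by (subst Bochner_Integration.integral_add) auto
    also have "\<dots> = 0" using \<eta>(2) by (simp add: N_def)
    finally obtain \<phi> where \<phi>: "\<phi> \<in> test_functions l" "\<And>x. vector_derivative \<phi> (at x) = \<rho> x"
      using test_function_antiderivative[OF \<rho> \<open>0 < l\<close>] by metis
    have intu: "integrable (lebesgue_on {0<..<l}) (\<lambda>x. u x * \<psi> x)"
      "integrable (lebesgue_on {0<..<l}) (\<lambda>x. u x * \<eta> x)"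
      by (intro integrable_mult_test_function u \<psi> \<eta>)+
    have "0 = (LINT x|lebesgue_on {0<..<l}. u x * \<rho> x)"
      using assms(1) \<phi> by (auto simp: is_weak_deriv_def dest!: bspec[of _ _ \<phi>])
    also have "\<dots> = (LINT x|lebesgue_on {0<..<l}. u x * \<psi> x + (- I / N) * (u x * \<eta> x))"
      by (simp add: \<rho>_def algebra_simps)
    also have "\<dots> = (LINT x|lebesgue_on {0<..<l}. u x * \<psi> x) + (- I / N) * (m * N)"
      using intu \<eta>(2) unfolding m_def N_def by (subst Bochner_Integration.integral_add) auto
    also have "\<dots> = (LINT x|lebesgue_on {0<..<l}. u x * \<psi> x) - m * I"
      using \<eta>(2) by (simp add: N_def)
    also have "\<dots> = (LINT x|lebesgue_on {0<..<l}. (u x - m) * \<psi> x)"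
      using intu int by (simp add: left_diff_distrib I_def)
    finally show "(LINT x|lebesgue_on {0<..<l}. (u x - m) * \<psi> x) = 0" by simp
  qed
  then show thesis using that[of m] by simp
qed


subsection \<open>Classical representatives\<close>

text \<open>Since \<open>wderiv\<close> is a Hilbert choice, it can be compared with a known weak
  derivative only almost everywhere, through uniqueness.\<close>

lemma wderiv_spec:
  assumes "is_weak_deriv l u g" "g \<in> L2 l"
  shows "wderiv l u \<in> L2 l" "is_weak_deriv l u (wderiv l u)"
    "AE x in lebesgue_on {0<..<l}. wderiv l u x = g x"
proof -
  have *: "wderiv l u \<in> L2 l \<and> is_weak_deriv l u (wderiv l u)"
    unfolding wderiv_def by (rule someI[of _ g]) (use assms in auto)
  then show "wderiv l u \<in> L2 l" "is_weak_deriv l u (wderiv l u)" by auto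
  show "AE x in lebesgue_on {0<..<l}. wderiv l u x = g x"
    using weak_deriv_unique * assms by blast
qed

lemma W12D:
  assumes "u \<in> W12 l"
  shows "u \<in> L2 l" "wderiv l u \<in> L2 l" "is_weak_deriv l u (wderiv l u)"
proof -
  obtain g where g: "u \<in> L2 l" "g \<in> L2 l" "is_weak_deriv l u g"
    using assms by (auto simp: W12_def)
  show "u \<in> L2 l" "wderiv l u \<in> L2 l" "is_weak_deriv l u (wderiv l u)"
    by (fact g(1) wderiv_spec[OF g(3,2)])+
qed

lemma W12I: "u \<in> L2 l \<Longrightarrow> is_weak_deriv l u g \<Longrightarrow> g \<in> L2 l \<Longrightarrow> u \<in> W12 l"
  by (auto simp: W12_def)

lemma ddx_plus_W12:
  assumes "u \<in> W22 l"
  shows "ddx_plus l \<tau> u \<in> W12 l"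
proof -
  have u: "u \<in> W12 l" "wderiv l u \<in> W12 l" using assms by (auto simp: W22_def)
  note D = W12D[OF u(1)] W12D[OF u(2)]
  show ?thesis
    unfolding ddx_plus_def
    by (rule W12I[OF _ is_weak_deriv_add[OF D(6) is_weak_deriv_cmult[OF D(3)]]])
       (intro L2_add L2_cmult D)+
qed

section \<open>Functions with a C^1 representative and their point values\<close>

lemma has_vector_derivative_imp_continuous_on:
  assumes "\<And>x. (U has_vector_derivative U' x) (at x)"
  shows "continuous_on S U"
  by (intro continuous_at_imp_continuous_on ballI has_vector_derivative_continuous[OF assms])

context
  fixes l :: real and u U U' :: "real \<Rightarrow> complex"
  assumes l: "0 < l" and u: "u \<in> L2 l" and uU: "AE x in lebesgue_on {0<..<l}. u x = U x"
    and U: "\<And>x. (U has_vector_derivative U' x) (at x)" "continuous_on UNIV U'"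
begin

text \<open>Weak derivatives do not see null sets, so the classical derivative of the representative
  \<open>U\<close> is a weak derivative of \<open>u\<close>. This is the bridge from explicit
  exponentials to \<open>wderiv\<close> and \<open>ddx_plus\<close>.\<close>

lemma is_weak_deriv_classical: "is_weak_deriv l u U'"
  and classical_deriv_L2: "U' \<in> L2 l"
proof -
  have L2: "U \<in> L2 l" "U' \<in> L2 l"
    using U(2) has_vector_derivative_imp_continuous_on[OF U(1)]
    by (meson continuous_imp_L2 continuous_on_subset subset_UNIV)+
  show "is_weak_deriv l u U'" "U' \<in> L2 l"
    using uU by (auto intro!: is_weak_deriv_cong_AE[OF is_weak_deriv_C1[OF l U] L2(1) u L2(2) L2(2)] L2
        elim: AE_mp)
qed

lemma W12_classical: "u \<in> W12 l"
  by (rule W12I[OF u is_weak_deriv_classical classical_deriv_L2])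

lemma wderiv_classical: "AE x in lebesgue_on {0<..<l}. wderiv l u x = U' x"
  by (rule wderiv_spec[OF is_weak_deriv_classical classical_deriv_L2])

lemma ddx_plus_classical:
  "AE x in lebesgue_on {0<..<l}. ddx_plus l \<tau> u x = U' x + \<i> * of_real \<tau> * U x"
  using wderiv_classical uU by eventually_elim (simp add: ddx_plus_def)

lemma ddx_plus_classical_L2: "ddx_plus l \<tau> u \<in> L2 l"
  unfolding ddx_plus_def by (intro L2_add L2_cmult u W12D(2) W12_classical)

end

text \<open>A difference at one point persists on a neighbourhood by continuity, and that
  neighbourhood meets the interval in a set of positive measure. End points are included, which is
  what boundary values need.\<close>

lemma continuous_AE_eq_imp_eq:
  fixes f g :: "real \<Rightarrow> complex"
  assumes f: "continuous_on {0..l} f" and g: "continuous_on {0..l} g" and "0 < l"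
    and AE: "AE x in lebesgue_on {0<..<l}. f x = g x" and x: "x \<in> {0..l}"
  shows "f x = g x"
proof (rule ccontr)
  assume neq: "f x \<noteq> g x"
  define d where "d = (\<lambda>y. f y - g y)"
  have "continuous_on {0..l} d" unfolding d_def by (intro continuous_intros f g)
  then obtain \<delta> where \<delta>: "\<delta> > 0" "\<And>y. y \<in> {0..l} \<Longrightarrow> dist y x < \<delta> \<Longrightarrow> dist (d y) (d x) < norm (d x)"
    using x neq unfolding continuous_on_iff d_def
    by (metis right_minus_eq zero_less_norm_iff)
  \<comment> \<open>At an end point the truncated neighbourhood is one-sided but still has positive
    length.\<close>
  define a b where "a = max 0 (x - \<delta>)" and "b = min l (x + \<delta>)"
  have "a < b" using x \<open>0 < l\<close> \<delta>(1) by (auto simp: a_def b_def)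
  have d: "d y \<noteq> 0" if "y \<in> {a<..<b}" for y
    using \<delta>(2)[of y] that by (auto simp: a_def b_def dist_norm abs_less_iff)
  have "AE y in lebesgue. y \<in> {0<..<l} \<longrightarrow> f y = g y"
    using AE by (subst (asm) AE_restrict_space_iff) auto
  then have "AE y in lebesgue. y \<notin> {a<..<b}"
    by eventually_elim (use d in \<open>auto simp: d_def a_def b_def\<close>)
  then have "{a<..<b} \<in> null_sets lebesgue"
    by (subst (asm) AE_iff_null_sets[symmetric]) auto
  with \<open>a < b\<close> show False by (auto simp: null_sets_def)
qed

lemma pointval_eq:
  assumes "AE x in lebesgue_on {0<..<l}. u x = U x" "continuous_on {0..l} U" "0 < l" "x \<in> {0..l}"
  shows "pointval l u x = U x"
  unfolding pointval_def
proof (rule the_equality)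
  show "\<exists>g. continuous_on {0..l} g \<and> (AE y in lebesgue_on {0<..<l}. g y = u y) \<and> U x = g x"
    using assms by (intro exI[of _ U]) (auto elim: AE_mp)
  fix c assume "\<exists>g. continuous_on {0..l} g \<and> (AE y in lebesgue_on {0<..<l}. g y = u y) \<and> c = g x"
  then obtain g where g: "continuous_on {0..l} g" "AE y in lebesgue_on {0<..<l}. g y = u y" "c = g x"
    by blast
  have "AE y in lebesgue_on {0<..<l}. g y = U y"
    using g(2) assms(1) by eventually_elim simp
  with g show "c = U x"
    using continuous_AE_eq_imp_eq assms by blast
qed


subsection \<open>Solutions of the spectral equation\<close>

text \<open>For nonzero \<open>s\<close> this is the general solution of
  \<open>(d/dx + i tau)^2 y = s^2 y\<close>. Applying \<open>d/dx + i tau\<close> multiplies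
  \<open>A\<close> by \<open>s\<close> and \<open>B\<close> by \<open>- s\<close>, so the flux is
  again of this form.\<close>

definition sol :: "complex \<Rightarrow> real \<Rightarrow> complex \<Rightarrow> complex \<Rightarrow> real \<Rightarrow> complex" where
  "sol s \<tau> A B x = A * exp ((s - \<i> * of_real \<tau>) * of_real x) + B * exp ((- s - \<i> * of_real \<tau>) * of_real x)"

lemma has_vector_derivative_exp_mult:
  fixes \<alpha> :: complex
  shows "((\<lambda>x. exp (\<alpha> * of_real x)) has_vector_derivative \<alpha> * exp (\<alpha> * of_real x)) (at x)"
proof -
  have "((\<lambda>w. exp (\<alpha> * w)) has_field_derivative \<alpha> * exp (\<alpha> * of_real x)) (at (of_real x))"
    by (rule derivative_eq_intros refl | simp)+
  from has_vector_derivative_real_field[OF this] show ?thesis .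
qed

lemma sol_deriv:
  "(sol s \<tau> A B has_vector_derivative sol s \<tau> (s * A) (- s * B) x - \<i> * of_real \<tau> * sol s \<tau> A B x) (at x)"
proof -
  have "((\<lambda>x. A * exp ((s - \<i> * of_real \<tau>) * of_real x) + B * exp ((- s - \<i> * of_real \<tau>) * of_real x))
      has_vector_derivative
        A * ((s - \<i> * of_real \<tau>) * exp ((s - \<i> * of_real \<tau>) * of_real x))
        + B * ((- s - \<i> * of_real \<tau>) * exp ((- s - \<i> * of_real \<tau>) * of_real x))) (at x)"
    by (intro has_vector_derivative_add has_vector_derivative_mult_right has_vector_derivative_exp_mult)
  then show ?thesis by (simp add: sol_def[abs_def] algebra_simps)
qed

lemma continuous_on_sol: "continuous_on S (sol s \<tau> A B)"
  by (rule has_vector_derivative_imp_continuous_on[OF sol_deriv])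

text \<open>Integrating factor: multiplied by \<open>exp (- \<alpha> * x)\<close>, the function has
  weak derivative zero and is therefore constant.\<close>

lemma weak_exponential:
  assumes "is_weak_deriv l h (\<lambda>x. \<alpha> * h x)" "h \<in> L2 l" "0 < l"
  obtains C where "AE x in lebesgue_on {0<..<l}. h x = C * exp (\<alpha> * of_real x)"
proof -
  define \<psi> where "\<psi> = (\<lambda>x::real. exp (- \<alpha> * of_real x))"
  have \<psi>: "(\<psi> has_vector_derivative - \<alpha> * \<psi> x) (at x)" for x
    unfolding \<psi>_def by (rule has_vector_derivative_exp_mult)
  have cont: "continuous_on S \<psi>" for S
    by (rule has_vector_derivative_imp_continuous_on[OF \<psi>])
  have "is_weak_deriv l (\<lambda>x. \<psi> x * h x) (\<lambda>x. \<psi> x * (\<alpha> * h x) + (- \<alpha> * \<psi> x) * h x)"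
    by (intro is_weak_deriv_mult assms L2_cmult \<psi> continuous_intros cont)
  then have "is_weak_deriv l (\<lambda>x. \<psi> x * h x) (\<lambda>x. 0)" by (simp add: algebra_simps)
  then obtain C where "AE x in lebesgue_on {0<..<l}. \<psi> x * h x = C"
    using weak_deriv_0_imp_const L2_mult_continuous[OF assms(2) cont] \<open>0 < l\<close> by metis
  then have "AE x in lebesgue_on {0<..<l}. h x = C * exp (\<alpha> * of_real x)"
    by eventually_elim (auto simp: \<psi>_def exp_minus)
  then show thesis by (rule that)
qed

text \<open>The combinations \<open>q \<plusminus> s u\<close> diagonalise the first-order system for \<open>(u, q)\<close>.\<close>

lemma weak_solution:
  assumes u: "u \<in> L2 l" and q: "q \<in> L2 l" and "0 < l" "s \<noteq> 0"
    and du: "is_weak_deriv l u (\<lambda>x. q x - \<i> * of_real \<tau> * u x)"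
    and dq: "is_weak_deriv l q (\<lambda>x. - \<i> * of_real \<tau> * q x + s\<^sup>2 * u x)"
  obtains A B where "AE x in lebesgue_on {0<..<l}. u x = sol s \<tau> A B x"
proof -
  \<comment> \<open>The two choices \<open>r = s\<close> and \<open>r = - s\<close> are both used;
    \<open>r^2 = s^2\<close> is exactly what makes the derivative of \<open>q + r * u\<close> a
    multiple of \<open>q + r * u\<close>.\<close>
  have *: "\<exists>C. AE x in lebesgue_on {0<..<l}. q x + r * u x = C * exp ((r - \<i> * of_real \<tau>) * of_real x)"
    if "r\<^sup>2 = s\<^sup>2" for r
  proof -
    have "is_weak_deriv l (\<lambda>x. q x + r * u x)
        (\<lambda>x. (- \<i> * of_real \<tau> * q x + s\<^sup>2 * u x) + r * (q x - \<i> * of_real \<tau> * u x))"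
      by (intro is_weak_deriv_add dq is_weak_deriv_cmult du L2_add L2_diff L2_cmult u q)
    also have "(\<lambda>x. (- \<i> * of_real \<tau> * q x + s\<^sup>2 * u x) + r * (q x - \<i> * of_real \<tau> * u x))
        = (\<lambda>x. (r - \<i> * of_real \<tau>) * (q x + r * u x))"
      by (simp only: that[symmetric]) (simp add: fun_eq_iff power2_eq_square algebra_simps)
    finally show ?thesis
      using weak_exponential[OF _ _ \<open>0 < l\<close>] L2_add[OF q L2_cmult[OF u]] by metis
  qed
  obtain C D where "AE x in lebesgue_on {0<..<l}. q x + s * u x = C * exp ((s - \<i> * of_real \<tau>) * of_real x)"
    and "AE x in lebesgue_on {0<..<l}. q x + (- s) * u x = D * exp ((- s - \<i> * of_real \<tau>) * of_real x)"
    using *[of s] *[of "- s"] by auto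
  then have "AE x in lebesgue_on {0<..<l}. u x = sol s \<tau> (C / (2 * s)) (- D / (2 * s)) x"
  proof eventually_elim
    case (elim x)
    \<comment> \<open>Subtracting the two combinations eliminates \<open>q\<close>; the remaining
      factor \<open>2 * s\<close> is nonzero.\<close>
    have "2 * s * u x = (q x + s * u x) - (q x + (- s) * u x)" by simp
    also have "\<dots> = C * exp ((s - \<i> * of_real \<tau>) * of_real x) - D * exp ((- s - \<i> * of_real \<tau>) * of_real x)"
      by (simp only: elim)
    finally show ?case using \<open>s \<noteq> 0\<close> by (simp add: sol_def field_simps)
  qed
  then show thesis by (rule that)
qed

text \<open>The term \<open>- i tau\<close> times the solution in the classical derivative cancels
  against the zeroth-order term of \<open>ddx_plus\<close>, which leaves a continuous flux.\<close>

lemma pointval_sol: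
  assumes "0 < l" "u \<in> L2 l" "AE x in lebesgue_on {0<..<l}. u x = sol s \<tau> A B x" "x \<in> {0..l}"
  shows "pointval l u x = sol s \<tau> A B x"
    and "pointval l (ddx_plus l \<tau> u) x = sol s \<tau> (s * A) (- s * B) x"
proof -
  show "pointval l u x = sol s \<tau> A B x"
    by (intro pointval_eq assms continuous_on_sol)
  have "AE x in lebesgue_on {0<..<l}. ddx_plus l \<tau> u x = (sol s \<tau> (s * A) (- s * B) x
      - \<i> * of_real \<tau> * sol s \<tau> A B x) + \<i> * of_real \<tau> * sol s \<tau> A B x"
    by (intro ddx_plus_classical assms sol_deriv continuous_intros continuous_on_sol)
  then show "pointval l (ddx_plus l \<tau> u) x = sol s \<tau> (s * A) (- s * B) x"
    by (intro pointval_eq assms continuous_on_sol) simp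
qed

text \<open>With \<open>q\<close> the image of \<open>u\<close> under \<open>d/dx + i tau\<close>,
  the second-order equation becomes the first-order weak system solved above.\<close>

lemma W22_solution:
  assumes u: "u \<in> W22 l" and "0 < l" "s \<noteq> 0"
    and eq: "AE x in lebesgue_on {0<..<l}. - ddx_plus l \<tau> (ddx_plus l \<tau> u) x = - s\<^sup>2 * u x"
  obtains A B where "AE x in lebesgue_on {0<..<l}. u x = sol s \<tau> A B x"
proof -
  have u1: "u \<in> W12 l" using u by (simp add: W22_def)
  define q where "q = ddx_plus l \<tau> u"
  have q: "q \<in> W12 l" using ddx_plus_W12[OF u] by (simp add: q_def)
  have "is_weak_deriv l u (\<lambda>x. q x - \<i> * of_real \<tau> * u x)"
    using W12D(3)[OF u1] by (simp add: q_def ddx_plus_def)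
  moreover have "AE x in lebesgue_on {0<..<l}. wderiv l q x = - \<i> * of_real \<tau> * q x + s\<^sup>2 * u x"
    using eq unfolding q_def[symmetric]
    by eventually_elim (simp add: ddx_plus_def algebra_simps)
  then have "is_weak_deriv l q (\<lambda>x. - \<i> * of_real \<tau> * q x + s\<^sup>2 * u x)"
    by (intro is_weak_deriv_cong_AE[OF W12D(3)[OF q]] L2_add L2_cmult W12D[OF q] W12D[OF u1]) auto
  ultimately show thesis
    by (rule weak_solution[OF W12D(1)[OF u1] W12D(1)[OF q] \<open>0 < l\<close> \<open>s \<noteq> 0\<close>]) (rule that)
qed


subsection \<open>The Dirichlet resolvent\<close>

text \<open>An element of the kernel of \<open>(d/dx + i\<tau>)\<^sup>2\<close> with value 1 at 0, and its image under \<open>d/dx + i\<tau>\<close>.\<close>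

definition kernel_fun :: "complex \<Rightarrow> real \<Rightarrow> real \<Rightarrow> complex" where
  "kernel_fun c \<tau> x = (1 + c * of_real x) * exp (- \<i> * of_real \<tau> * of_real x)"

definition kernel_flux :: "complex \<Rightarrow> real \<Rightarrow> real \<Rightarrow> complex" where
  "kernel_flux c \<tau> x = c * exp (- \<i> * of_real \<tau> * of_real x)"

lemma kernel_fun_deriv: "(kernel_fun c \<tau> has_vector_derivative kernel_flux c \<tau> x - \<i> * of_real \<tau> * kernel_fun c \<tau> x) (at x)"
proof -
  have 1: "((\<lambda>x. 1 + c * of_real x) has_vector_derivative c) (at x)"
    by (auto intro!: derivative_eq_intros)
  have 2: "((\<lambda>x. (1 + c * of_real x) * exp (- \<i> * of_real \<tau> * of_real x)) has_vector_derivative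
      (1 + c * of_real x) * (- \<i> * of_real \<tau> * exp (- \<i> * of_real \<tau> * of_real x))
      + c * exp (- \<i> * of_real \<tau> * of_real x)) (at x)"
    by (intro has_vector_derivative_mult 1 has_vector_derivative_exp_mult)
  then show ?thesis by (simp add: kernel_fun_def[abs_def] kernel_flux_def algebra_simps)
qed

lemma kernel_flux_deriv: "(kernel_flux c \<tau> has_vector_derivative - \<i> * of_real \<tau> * kernel_flux c \<tau> x) (at x)"
proof -
  have "((\<lambda>x. c * exp (- \<i> * of_real \<tau> * of_real x)) has_vector_derivative
      c * (- \<i> * of_real \<tau> * exp (- \<i> * of_real \<tau> * of_real x))) (at x)"
    by (intro has_vector_derivative_mult_right has_vector_derivative_exp_mult)
  then show ?thesis by (simp add: kernel_flux_def[abs_def] algebra_simps)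
qed

lemma continuous_on_kernel_fun: "continuous_on S (kernel_fun c \<tau>)"
  and continuous_on_kernel_flux: "continuous_on S (kernel_flux c \<tau>)"
  by (rule has_vector_derivative_imp_continuous_on[OF kernel_fun_deriv]
      has_vector_derivative_imp_continuous_on[OF kernel_flux_deriv])+

lemma pointval_ddx_kernel_fun:
  assumes "0 < l" "x \<in> {0..l}"
  shows "pointval l (ddx_plus l \<tau> (kernel_fun c \<tau>)) x = kernel_flux c \<tau> x"
proof -
  have "AE x in lebesgue_on {0<..<l}. ddx_plus l \<tau> (kernel_fun c \<tau>) x
      = (kernel_flux c \<tau> x - \<i> * of_real \<tau> * kernel_fun c \<tau> x) + \<i> * of_real \<tau> * kernel_fun c \<tau> x"
    by (intro ddx_plus_classical assms kernel_fun_deriv continuous_imp_L2 continuous_intros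
        continuous_on_kernel_fun continuous_on_kernel_flux AE_I2 refl)
  then show ?thesis
    by (intro pointval_eq assms continuous_on_kernel_flux) simp
qed

text \<open>Since \<open>(d/dx + i\<tau>)\<^sup>2\<close> annihilates the right-hand side, \<open>z R + v\<close> solves the homogeneous equation.\<close>

lemma resolvent_solution:
  assumes R: "R \<in> W22 l" and "0 < l" "s \<noteq> 0" and z: "z = - s\<^sup>2"
    and eq: "AE x in lebesgue_on {0<..<l}. AD l \<tau> R x - z * R x = kernel_fun c \<tau> x"
  obtains A B where "AE x in lebesgue_on {0<..<l}. z * R x + kernel_fun c \<tau> x = sol s \<tau> A B x"
proof -
  have R1: "R \<in> W12 l" using R by (simp add: W22_def)
  define p where "p = ddx_plus l \<tau> R"
  have p: "p \<in> W12 l" using ddx_plus_W12[OF R] by (simp add: p_def)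
  note L2 = W12D(1,2)[OF R1] W12D(1,2)[OF p] continuous_imp_L2[OF continuous_on_kernel_fun]
    continuous_imp_L2[OF continuous_on_kernel_flux]
  \<comment> \<open>By linearity, \<open>q\<close> is the image of \<open>u\<close> under
    \<open>d/dx + i tau\<close>.\<close>
  define u where "u = (\<lambda>x. z * R x + kernel_fun c \<tau> x)"
  define q where "q = (\<lambda>x. z * p x + kernel_flux c \<tau> x)"
  have uq: "u \<in> L2 l" "q \<in> L2 l"
    unfolding u_def q_def by (intro L2_add L2_cmult L2)+
  have "is_weak_deriv l (kernel_fun c \<tau>) (\<lambda>x. kernel_flux c \<tau> x - \<i> * of_real \<tau> * kernel_fun c \<tau> x)"
    by (intro is_weak_deriv_C1 \<open>0 < l\<close> kernel_fun_deriv continuous_intros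
        continuous_on_kernel_fun continuous_on_kernel_flux)
  then have "is_weak_deriv l u (\<lambda>x. z * wderiv l R x + (kernel_flux c \<tau> x - \<i> * of_real \<tau> * kernel_fun c \<tau> x))"
    unfolding u_def
    by (intro is_weak_deriv_add is_weak_deriv_cmult W12D(3)[OF R1] L2_cmult L2_diff L2)
  moreover have "(\<lambda>x. z * wderiv l R x + (kernel_flux c \<tau> x - \<i> * of_real \<tau> * kernel_fun c \<tau> x))
      = (\<lambda>x. q x - \<i> * of_real \<tau> * u x)"
    by (simp add: fun_eq_iff q_def u_def p_def ddx_plus_def algebra_simps)
  ultimately have du: "is_weak_deriv l u (\<lambda>x. q x - \<i> * of_real \<tau> * u x)" by simp
  have "is_weak_deriv l (kernel_flux c \<tau>) (\<lambda>x. - \<i> * of_real \<tau> * kernel_flux c \<tau> x)"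
    by (intro is_weak_deriv_C1 \<open>0 < l\<close> kernel_flux_deriv continuous_intros continuous_on_kernel_flux)
  then have dq': "is_weak_deriv l q (\<lambda>x. z * wderiv l p x + (- \<i> * of_real \<tau> * kernel_flux c \<tau> x))"
    unfolding q_def
    by (intro is_weak_deriv_add is_weak_deriv_cmult W12D(3)[OF p] L2_cmult L2)
  have "AE x in lebesgue_on {0<..<l}.
      z * wderiv l p x + (- \<i> * of_real \<tau> * kernel_flux c \<tau> x) = - \<i> * of_real \<tau> * q x + s\<^sup>2 * u x"
    using eq
  proof eventually_elim
    case (elim x)
    then have "kernel_fun c \<tau> x = - (wderiv l p x + \<i> * of_real \<tau> * p x) - z * R x"
      by (simp add: AD_def p_def[symmetric] ddx_plus_def[of l \<tau> p])
    \<comment> \<open>The resolvent equation says that \<open>d/dx + i tau\<close> maps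
      \<open>p\<close> to \<open>- (z * R + v)\<close>, that is, to \<open>- u\<close>.\<close>
    then have W: "wderiv l p x = - \<i> * of_real \<tau> * p x - u x"
      by (simp add: u_def)
    show ?case unfolding q_def z W by (simp add: algebra_simps)
  qed
  then have dq: "is_weak_deriv l q (\<lambda>x. - \<i> * of_real \<tau> * q x + s\<^sup>2 * u x)"
    by (intro is_weak_deriv_cong_AE[OF dq' uq(2) uq(2) _ _ AE_I2[OF refl]] L2_add L2_cmult L2 uq)
  from weak_solution[OF uq \<open>0 < l\<close> \<open>s \<noteq> 0\<close> du dq] that show thesis
    unfolding u_def by metis
qed

text \<open>Division by \<open>z\<close> exhibits an explicit C^1 representative of
  \<open>R\<close>, from which values and fluxes at the end points can be read off.\<close>

lemma pointval_resolvent: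
  assumes R: "R \<in> L2 l" and "0 < l" "z \<noteq> 0"
    and eq: "AE x in lebesgue_on {0<..<l}. z * R x + kernel_fun c \<tau> x = sol s \<tau> A B x" and x: "x \<in> {0..l}"
  shows "z * pointval l R x = sol s \<tau> A B x - kernel_fun c \<tau> x"
    and "z * pointval l (ddx_plus l \<tau> R) x = sol s \<tau> (s * A) (- s * B) x - kernel_flux c \<tau> x"
proof -
  define U where "U = (\<lambda>x. (1 / z) * (sol s \<tau> A B x - kernel_fun c \<tau> x))"
  define U' where "U' = (\<lambda>x. (1 / z) * ((sol s \<tau> (s * A) (- s * B) x - \<i> * of_real \<tau> * sol s \<tau> A B x)
      - (kernel_flux c \<tau> x - \<i> * of_real \<tau> * kernel_fun c \<tau> x)))"
  note cont = continuous_intros continuous_on_sol continuous_on_kernel_fun continuous_on_kernel_flux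
  have U: "(U has_vector_derivative U' x) (at x)" for x
    unfolding U_def U'_def
    by (intro has_vector_derivative_mult_right has_vector_derivative_diff sol_deriv kernel_fun_deriv)
  have RU: "AE x in lebesgue_on {0<..<l}. R x = U x"
    using eq by eventually_elim (use \<open>z \<noteq> 0\<close> in \<open>simp add: U_def field_simps\<close>)
  have "pointval l R x = U x"
    by (rule pointval_eq[OF RU _ \<open>0 < l\<close> x]) (unfold U_def, intro cont)
  then show "z * pointval l R x = sol s \<tau> A B x - kernel_fun c \<tau> x"
    using \<open>z \<noteq> 0\<close> by (simp add: U_def)
  have contU': "continuous_on UNIV U'" unfolding U'_def by (intro cont)
  have "pointval l (ddx_plus l \<tau> R) x = U' x + \<i> * of_real \<tau> * U x"
    by (rule pointval_eq[OF ddx_plus_classical[OF \<open>0 < l\<close> R RU U contU'] _ \<open>0 < l\<close> x])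
       (unfold U_def U'_def, intro cont)
  then show "z * pointval l (ddx_plus l \<tau> R) x = sol s \<tau> (s * A) (- s * B) x - kernel_flux c \<tau> x"
    using \<open>z \<noteq> 0\<close> by (simp add: U_def U'_def distrib_left mult.left_commute[of z]) (simp add: algebra_simps)
qed

text \<open>Guarantees that the choice in \<open>AD_resolvent\<close> denotes a genuine preimage.
  The witness is \<open>(sol - v) / z\<close>: the differential expression multiplies
  \<open>sol\<close> by \<open>z\<close> and annihilates \<open>v\<close>, so it maps the witness to
  \<open>sol\<close>, and subtracting \<open>z\<close> times the witness leaves \<open>v\<close>.
  Matching boundary values give the Dirichlet conditions.\<close>

lemma resolvent_exists:
  assumes "0 < l" "z \<noteq> 0" and z: "z = - s\<^sup>2"
    and A: "sol s \<tau> A B 0 = kernel_fun c \<tau> 0" "sol s \<tau> A B l = kernel_fun c \<tau> l"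
  shows "\<exists>R. R \<in> dom_AD l \<and> (AE x in lebesgue_on {0<..<l}. AD l \<tau> R x - z * R x = kernel_fun c \<tau> x)"
proof -
  define R where "R = (\<lambda>x. (1 / z) * (sol s \<tau> A B x - kernel_fun c \<tau> x))"
  define Q where "Q = (\<lambda>x. (1 / z) * (sol s \<tau> (s * A) (- s * B) x - kernel_flux c \<tau> x))"
  define R' where "R' = (\<lambda>x. Q x - \<i> * of_real \<tau> * R x)"
  \<comment> \<open>The second term arises as \<open>s^2 / z = -1\<close> times the
    solution.\<close>
  define Q' where "Q' = (\<lambda>x. - \<i> * of_real \<tau> * Q x - sol s \<tau> A B x)"
  note cont = continuous_intros continuous_on_sol continuous_on_kernel_fun continuous_on_kernel_flux
  have R: "(R has_vector_derivative R' x) (at x)" for x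
  proof -
    have "(R has_vector_derivative (1 / z) * ((sol s \<tau> (s * A) (- s * B) x - \<i> * of_real \<tau> * sol s \<tau> A B x)
      - (kernel_flux c \<tau> x - \<i> * of_real \<tau> * kernel_fun c \<tau> x))) (at x)"
      unfolding R_def
      by (intro has_vector_derivative_mult_right has_vector_derivative_diff sol_deriv kernel_fun_deriv)
    then show ?thesis by (simp add: R'_def Q_def R_def algebra_simps)
  qed
  have Q: "(Q has_vector_derivative Q' x) (at x)" for x
  proof -
    have "(Q has_vector_derivative (1 / z) *
        ((sol s \<tau> (s * (s * A)) (- s * (- s * B)) x - \<i> * of_real \<tau> * sol s \<tau> (s * A) (- s * B) x)
      - (- \<i> * of_real \<tau> * kernel_flux c \<tau> x))) (at x)"
      unfolding Q_def
      by (intro has_vector_derivative_mult_right has_vector_derivative_diff sol_deriv kernel_flux_deriv)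
    moreover have "sol s \<tau> (s * (s * A)) (- s * (- s * B)) x = - z * sol s \<tau> A B x"
      by (simp add: sol_def z power2_eq_square algebra_simps)
    ultimately show ?thesis
      using \<open>z \<noteq> 0\<close> by (simp add: Q'_def Q_def field_simps)
  qed
  have contR: "continuous_on S R" and contQ: "continuous_on S Q" for S
    by (rule has_vector_derivative_imp_continuous_on[OF R]
        has_vector_derivative_imp_continuous_on[OF Q])+
  have contR': "continuous_on S R'" and contQ': "continuous_on S Q'" for S
    unfolding R'_def Q'_def by (intro cont contR contQ)+
  note clR = \<open>0 < l\<close> continuous_imp_L2[OF contR] AE_I2[OF refl] R contR'
  \<comment> \<open>The chosen \<open>wderiv l R\<close> agrees with \<open>R'\<close> only almost
    everywhere, so the lemmas on C^1 representatives are used a second time, with \<open>R'\<close>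
    as the representative.\<close>
  have W: "wderiv l R \<in> W12 l"
  proof (rule W12_classical[OF \<open>0 < l\<close>])
    show "wderiv l R \<in> L2 l" by (rule W12D(2)[OF W12_classical[OF clR]])
    show "AE x in lebesgue_on {0<..<l}. wderiv l R x = R' x" by (rule wderiv_classical[OF clR])
    show "(R' has_vector_derivative Q' x - \<i> * of_real \<tau> * R' x) (at x)" for x
      unfolding R'_def by (intro has_vector_derivative_mult_right has_vector_derivative_diff Q R[unfolded R'_def])
    show "continuous_on UNIV (\<lambda>x. Q' x - \<i> * of_real \<tau> * R' x)"
      by (intro cont contR' contQ')
  qed
  have pv: "pointval l R x = R x" if "x \<in> {0..l}" for x
    by (rule pointval_eq[OF AE_I2[OF refl] contR \<open>0 < l\<close> that])
  have "R \<in> dom_AD l"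
    using W12_classical[OF clR] W A \<open>0 < l\<close> by (simp add: dom_AD_def W22_def pv) (simp add: R_def)
  moreover
  have "AE x in lebesgue_on {0<..<l}. ddx_plus l \<tau> R x = R' x + \<i> * of_real \<tau> * R x"
    by (rule ddx_plus_classical[OF clR])
  then have RQ: "AE x in lebesgue_on {0<..<l}. ddx_plus l \<tau> R x = Q x"
    by (simp add: R'_def)
  have "AE x in lebesgue_on {0<..<l}. ddx_plus l \<tau> (ddx_plus l \<tau> R) x = Q' x + \<i> * of_real \<tau> * Q x"
    by (rule ddx_plus_classical[OF \<open>0 < l\<close> ddx_plus_classical_L2[OF clR] RQ Q contQ'])
  then have "AE x in lebesgue_on {0<..<l}. AD l \<tau> R x - z * R x = kernel_fun c \<tau> x"
    by eventually_elim (use \<open>z \<noteq> 0\<close> in \<open>simp add: AD_def Q'_def R_def\<close>)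
  ultimately show ?thesis by blast
qed

text \<open>Cramer's rule for the two boundary conditions; the assumption is the nonvanishing of the
  determinant \<open>E - F\<close>, after the common phase \<open>e\<close> has been divided
  out.\<close>

lemma sol_boundary_value_exists:
  assumes "exp (s * of_real l) \<noteq> exp (- s * of_real l)"
  obtains A B where "sol s \<tau> A B 0 = a" "sol s \<tau> A B l = b"
proof -
  define E F e d where "E = exp (s * of_real l)" and "F = exp (- s * of_real l)"
    and "e = exp (- \<i> * of_real \<tau> * of_real l)" and "d = b / e"
  have "e \<noteq> 0" "E - F \<noteq> 0" using assms by (auto simp: e_def E_def F_def)
  have sol: "sol s \<tau> A B l = e * (A * E + B * F)" for A B
    by (simp add: sol_def e_def E_def F_def exp_add[symmetric] algebra_simps)
  define A B where "A = (d - a * F) / (E - F)" and "B = (a * E - d) / (E - F)"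
  have "A + B = a" "A * E + B * F = d"
    using \<open>E - F \<noteq> 0\<close> unfolding A_def B_def by (simp_all add: divide_simps) (simp_all add: algebra_simps)
  then have "sol s \<tau> A B 0 = a" "sol s \<tau> A B l = b"
    using \<open>e \<noteq> 0\<close> by (simp_all add: sol) (simp_all add: sol_def d_def)
  then show thesis by (rule that)
qed

subsection \<open>The boundary operator\<close>

text \<open>The phases from \<open>w\<close> and from the transport by \<open>tau\<close> merge into
  one unimodular number \<open>c\<close>. Eliminating \<open>A\<close> and \<open>B\<close> in
  favour of the boundary value leaves \<open>2 cos - (c + cnj c)\<close> over \<open>sin\<close>,
  whence the real part.\<close>

lemma dirichlet_to_neumann:
  assumes sin: "sin (of_real l * k) \<noteq> 0" and w: "w * cnj w = 1"
    and bc: "sol (\<i> * k) \<tau> A B 0 = \<mu>" "sol (\<i> * k) \<tau> A B l = \<mu> * w"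
  shows "- sol (\<i> * k) \<tau> (\<i> * k * A) (- (\<i> * k) * B) 0
      + cnj w * sol (\<i> * k) \<tau> (\<i> * k * A) (- (\<i> * k) * B) l
    = \<mu> * (2 * k * cos (of_real l * k) / sin (of_real l * k)
      - 2 * k / sin (of_real l * k) * of_real (Re (w * exp (\<i> * of_real (\<tau> * l)))))"
proof -
  define E F e where "E = exp (\<i> * (of_real l * k))" and "F = exp (- (\<i> * (of_real l * k)))"
    and "e = exp (\<i> * of_real (\<tau> * l))"
  define c where "c = w * e"
  define S C where "S = sin (of_real l * k)" and "C = cos (of_real l * k)"
  have EF: "E = C + \<i> * S" "F = C - \<i> * S"
    using exp_Euler[of "of_real l * k"] exp_Euler[of "- (of_real l * k)"]
    by (simp_all add: E_def F_def C_def S_def)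
  have ii: "\<i> * \<i> = -1" by simp
  have CS: "C\<^sup>2 + S\<^sup>2 = 1" by (simp add: C_def S_def)
  have e1: "cnj e * e = 1"
    by (simp add: e_def exp_cnj exp_add[symmetric])
  have e: "exp (- \<i> * of_real \<tau> * of_real l) = cnj e"
    by (simp add: e_def exp_cnj mult.assoc)
  have sol: "sol (\<i> * k) \<tau> A B l = cnj e * (A * E + B * F)" for A B
    unfolding e[symmetric] by (simp add: sol_def E_def F_def exp_add[symmetric] algebra_simps)
  have cc: "cnj c * c = 1" using w e1 by (simp add: c_def algebra_simps)
  have "A + B = \<mu>" using bc(1) by (simp add: sol_def)
  have "A * E + B * F = e * (cnj e * (A * E + B * F))" using e1 by (simp add: algebra_simps)
  also have "\<dots> = \<mu> * c" using bc(2) by (simp add: sol c_def)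
  finally have AB: "A * E + B * F = \<mu> * c" .
  \<comment> \<open>Splitting \<open>E\<close> and \<open>F\<close> by Euler's formula turns
    \<open>A * E + B * F\<close> into \<open>(A + B) * C + i * S * (A - B)\<close>, which can be
    solved for \<open>S * (A - B)\<close>.\<close>
  have d: "S * (A - B) = - \<i> * \<mu> * (c - C)"
    using AB \<open>A + B = \<mu>\<close> ii unfolding EF by algebra
  have wsol: "cnj w * sol (\<i> * k) \<tau> (\<i> * k * A) (- (\<i> * k) * B) l = \<i> * k * cnj c * (A * E - B * F)"
    by (simp add: sol c_def algebra_simps)
  \<comment> \<open>Likewise \<open>A * E - B * F\<close> is
    \<open>(A - B) * C + i * S * (A + B)\<close>; multiplying by \<open>S\<close> and using
    \<open>C^2 + S^2 = 1\<close> collapses the quadratic terms.\<close>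
  have X: "S * (A * E - B * F) = - \<i> * \<mu> * (c * C - 1)"
    using d \<open>A + B = \<mu>\<close> CS ii unfolding EF by algebra
  have "S * (- sol (\<i> * k) \<tau> (\<i> * k * A) (- (\<i> * k) * B) 0
      + cnj w * sol (\<i> * k) \<tau> (\<i> * k * A) (- (\<i> * k) * B) l)
      = - (\<i> * k) * (S * (A - B)) + \<i> * k * cnj c * (S * (A * E - B * F))"
    unfolding wsol by (simp add: sol_def algebra_simps)
  also have "\<dots> = k * \<mu> * (C - c + (cnj c * c) * C - cnj c)"
    unfolding d X by (simp add: algebra_simps)
  also have "\<dots> = k * \<mu> * (2 * C - (c + cnj c))"
    unfolding cc by (simp add: algebra_simps)
  also have "c + cnj c = 2 * of_real (Re c)" by (simp add: complex_add_cnj)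
  finally show ?thesis
    using sin unfolding S_def[symmetric] C_def[symmetric] c_def e_def
    by (simp add: field_simps)
qed

text \<open>Because the lengths add up to 1, the factor \<open>exp (i tau l2)\<close> turns the
  phases in \<open>xi\<close> into \<open>exp (i tau)\<close> and 1, giving minus the conjugate of
  the numerator of \<open>theta\<close>. The factor has modulus 1, so the normalisations
  agree.\<close>

lemma wtau_theta:
  assumes "l1 + l2 + l3 = (1::real)"
  shows "wtau a1 a3 l1 l2 l3 \<tau> * exp (\<i> * of_real (\<tau> * l2)) = cnj (theta a1 a3 l1 l3 \<tau>)"
proof -
  define e where "e = exp (\<i> * of_real (\<tau> * l2))"
  define n where "n = of_real (a1\<^sup>2 / l1) * exp (- \<i> * of_real \<tau>) + of_real (a3\<^sup>2 / l3)"
  have "\<i> * of_real (\<tau> * (l1 + l3)) + \<i> * of_real (\<tau> * l2) = \<i> * complex_of_real (\<tau> * (l1 + l2 + l3))"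
    by (simp add: algebra_simps)
  then have "exp (\<i> * of_real (\<tau> * (l1 + l3))) * e = exp (\<i> * of_real \<tau>)"
    unfolding e_def exp_add[symmetric] using assms by simp
  moreover have "exp (- \<i> * of_real (\<tau> * l2)) * e = 1"
    by (simp add: e_def exp_add[symmetric])
  ultimately have xi: "xi a1 a3 l1 l2 l3 \<tau> * e = - cnj n"
    by (simp add: xi_def n_def exp_cnj left_diff_distrib mult.assoc)
  have "cmod (xi a1 a3 l1 l2 l3 \<tau>) = cmod (xi a1 a3 l1 l2 l3 \<tau> * e)"
    by (simp add: norm_mult e_def)
  also have "\<dots> = cmod n" by (simp add: xi)
  finally have norm_xi: "cmod (xi a1 a3 l1 l2 l3 \<tau>) = cmod n" .
  have "wtau a1 a3 l1 l2 l3 \<tau> * e = - (xi a1 a3 l1 l2 l3 \<tau> * e) / of_real (cmod n)"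
    by (simp add: wtau_def norm_xi)
  also have "\<dots> = cnj (n / of_real (cmod n))" by (simp add: xi)
  finally show ?thesis
    unfolding theta_def n_def e_def .
qed

lemma wtau_unimodular:
  assumes "xi a1 a3 l1 l2 l3 \<tau> \<noteq> 0"
  shows "wtau a1 a3 l1 l2 l3 \<tau> * cnj (wtau a1 a3 l1 l2 l3 \<tau>) = 1"
proof -
  have "cmod (wtau a1 a3 l1 l2 l3 \<tau>) = 1"
    using assms by (simp add: wtau_def norm_divide)
  then show ?thesis by (simp add: complex_norm_square[symmetric])
qed

section \<open>The dispersion function and the boundary component of the spectral equation\<close>

theorem mainTheorem2:
  fixes a1 a3 l1 l2 l3 \<epsilon> \<tau> :: real and z :: complex
  assumes "a1 > 0" and "a3 > 0"
    and "l1 > 0" and "l2 > 0" and "l3 > 0" and "l1 + l2 + l3 = 1"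
    and "\<epsilon> \<in> {0<..<1}"
    and "\<tau> \<in> {-pi..<pi}"
    and "xi a1 a3 l1 l2 l3 \<tau> \<noteq> 0"
    and "\<And>k::int. of_real l2 * csqrt z \<noteq> of_real pi * of_int k"
  shows "(\<forall>u \<beta>. (u, \<beta>) \<in> dom_Ahom a1 a3 l1 l2 l3 \<tau> \<longrightarrow>
            (AE x in lebesgue_on {0<..<l2}. - ddx_plus l2 \<tau> (ddx_plus l2 \<tau> u) x = z * u x) \<longrightarrow>
            (snd (Ahom a1 a3 l1 l2 l3 \<epsilon> \<tau> (u, \<beta>)) = z * \<beta>
               \<longleftrightarrow> Ktau a1 a3 l1 l2 l3 \<epsilon> \<tau> z * \<beta> = z * \<beta>))
       \<and> Ktau a1 a3 l1 l2 l3 \<epsilon> \<tau> z =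
           of_real (1 / (l1 + l3)) *
             (2 * csqrt z * cos (of_real l2 * csqrt z) / sin (of_real l2 * csqrt z)
              - 2 * csqrt z / sin (of_real l2 * csqrt z) * of_real (Re (theta a1 a3 l1 l3 \<tau>))
              + of_real ((sigma_hom a1 a3 l1 l3 * \<tau> / \<epsilon>)\<^sup>2))"
proof -
  \<comment> \<open>With \<open>s = i k\<close> and \<open>k\<close> a square root of
    \<open>z\<close>, the equation has \<open>z = - s^2\<close> and the exponentials in
    \<open>sol\<close> oscillate with frequency \<open>k\<close>.\<close>
  define k s w where "k = csqrt z" and "s = \<i> * k" and "w = wtau a1 a3 l1 l2 l3 \<tau>"
  define c where "c = of_real (1 / l2) * (w * exp (\<i> * of_real (\<tau> * l2)) - 1)"
  define r where "r = complex_of_real (sqrt (l1 + l3))"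
  \<comment> \<open>The braces in the claimed formula are \<open>H + T\<close>: \<open>H\<close> is
    the flux jump per unit boundary value and \<open>T\<close> the contribution of the boundary
    component.\<close>
  define T where "T = complex_of_real ((sigma_hom a1 a3 l1 l3 * \<tau> / \<epsilon>)\<^sup>2)"
  define H where "H = 2 * k * cos (of_real l2 * k) / sin (of_real l2 * k)
      - 2 * k / sin (of_real l2 * k) * of_real (Re (theta a1 a3 l1 l3 \<tau>))"
  \<comment> \<open>The integer 0 in the non-resonance hypothesis excludes \<open>z = 0\<close>,
    which permits division by \<open>s\<close> and by \<open>z\<close>.\<close>
  have "k \<noteq> 0" using assms(10)[of 0] by (auto simp: k_def)
  then have "s \<noteq> 0" by (simp add: s_def)
  have z: "z = - s\<^sup>2" by (simp add: s_def k_def power_mult_distrib)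
  then have "z \<noteq> 0" using \<open>s \<noteq> 0\<close> by simp
  have sin: "sin (of_real l2 * k) \<noteq> 0"
    using assms(10) by (auto simp: sin_eq_0 k_def mult.commute)
  have ww: "w * cnj w = 1" using wtau_unimodular[OF assms(9)] by (simp add: w_def)
  have r: "r \<noteq> 0" "r * r = of_real (l1 + l3)"
    using assms(3,5) unfolding r_def of_real_mult[symmetric] by auto
  have Re_theta: "Re (w * exp (\<i> * of_real (\<tau> * l2))) = Re (theta a1 a3 l1 l3 \<tau>)"
    using wtau_theta[OF assms(6)] by (simp add: w_def)
  have jump: "- sol s \<tau> (s * A) (- s * B) 0 + cnj w * sol s \<tau> (s * A) (- s * B) l2 = \<mu> * H"
    if "sol s \<tau> A B 0 = \<mu>" "sol s \<tau> A B l2 = \<mu> * w" for A B \<mu>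
    using dirichlet_to_neumann[OF sin ww that[unfolded s_def]] unfolding s_def H_def Re_theta .
  have Gamma: "Gamma_tau a1 a3 l1 l2 l3 \<epsilon> \<tau> (u, \<beta>) = - pointval l2 (ddx_plus l2 \<tau> u) 0
      + cnj w * pointval l2 (ddx_plus l2 \<tau> u) l2 + T / r * \<beta>" for u \<beta>
    by (simp add: Gamma_tau_def w_def T_def r_def)

  have v: "vtau a1 a3 l1 l2 l3 \<tau> = kernel_fun c \<tau>"
    by (simp add: fun_eq_iff vtau_def kernel_fun_def c_def w_def mult.assoc)
  have v_bc: "kernel_fun c \<tau> 0 = 1" "kernel_fun c \<tau> l2 = w"
    using vtau_boundary[of l2 a1 a3 l1 l3 \<tau>] assms(4) unfolding v by (simp_all add: w_def)
  define R where "R = AD_resolvent l2 \<tau> z (kernel_fun c \<tau>)"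
  \<comment> \<open>This difference is \<open>2 i\<close> times the sine, so non-resonance is the
    solvability of the Dirichlet boundary value problem.\<close>
  have "exp (\<i> * (of_real l2 * k)) - exp (- (\<i> * (of_real l2 * k))) \<noteq> 0"
    using sin by (simp add: sin_exp_eq)
  then have "exp (s * of_real l2) \<noteq> exp (- s * of_real l2)"
    by (simp add: s_def mult_ac)
  then obtain A0 B0 where "sol s \<tau> A0 B0 0 = kernel_fun c \<tau> 0" "sol s \<tau> A0 B0 l2 = kernel_fun c \<tau> l2"
    using sol_boundary_value_exists by metis
  from resolvent_exists[OF assms(4) \<open>z \<noteq> 0\<close> z this]
  have "R \<in> dom_AD l2 \<and> (AE x in lebesgue_on {0<..<l2}. AD l2 \<tau> R x - z * R x = kernel_fun c \<tau> x)"
    unfolding R_def AD_resolvent_def by (rule someI_ex)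
  then have R: "R \<in> W22 l2" "R \<in> L2 l2" "pointval l2 R 0 = 0" "pointval l2 R l2 = 0"
    "AE x in lebesgue_on {0<..<l2}. AD l2 \<tau> R x - z * R x = kernel_fun c \<tau> x"
    by (auto simp: dom_AD_def W22_def W12_def)
  obtain A B where AB: "AE x in lebesgue_on {0<..<l2}. z * R x + kernel_fun c \<tau> x = sol s \<tau> A B x"
    using resolvent_solution[OF R(1) assms(4) \<open>s \<noteq> 0\<close> z R(5)] by metis
  note pR = pointval_resolvent[OF R(2) assms(4) \<open>z \<noteq> 0\<close> AB]
  \<comment> \<open>\<open>R\<close> vanishes at both ends, so \<open>z * R + v\<close> inherits the
    boundary values 1 and \<open>w\<close> of \<open>v\<close>; the second is written
    \<open>1 * w\<close> to match the boundary value 1 in \<open>jump\<close>.\<close>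
  have "sol s \<tau> A B 0 = 1" "sol s \<tau> A B l2 = 1 * w"
    using pR(1)[of 0] pR(1)[of l2] R(3,4) v_bc assms(4) by auto
  note jumpR = jump[OF this]
  \<comment> \<open>The two fluxes add up to that of a single homogeneous solution, and the boundary
    component \<open>r\<close> cancels the denominator of \<open>T / r\<close>.\<close>
  have "z * Gamma_tau a1 a3 l1 l2 l3 \<epsilon> \<tau> (R, 0) + Gamma_tau a1 a3 l1 l2 l3 \<epsilon> \<tau> (kernel_fun c \<tau>, r)
      = - (z * pointval l2 (ddx_plus l2 \<tau> R) 0 + kernel_flux c \<tau> 0)
        + cnj w * (z * pointval l2 (ddx_plus l2 \<tau> R) l2 + kernel_flux c \<tau> l2) + T"
    using pointval_ddx_kernel_fun[OF assms(4)] assms(4) r by (simp add: Gamma algebra_simps)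
  also have "\<dots> = H + T"
    using pR(2)[of 0] pR(2)[of l2] jumpR assms(4) by simp
  finally have K: "Ktau a1 a3 l1 l2 l3 \<epsilon> \<tau> z = of_real (1 / (l1 + l3)) * (H + T)"
    by (simp add: Ktau_def v R_def r_def)

  \<comment> \<open>More than the equivalence is shown: the boundary component equals
    \<open>Ktau\<close> times \<open>\<beta>\<close> outright.\<close>
  have "snd (Ahom a1 a3 l1 l2 l3 \<epsilon> \<tau> (u, \<beta>)) = Ktau a1 a3 l1 l2 l3 \<epsilon> \<tau> z * \<beta>"
    if dom: "(u, \<beta>) \<in> dom_Ahom a1 a3 l1 l2 l3 \<tau>"
      and eq: "AE x in lebesgue_on {0<..<l2}. - ddx_plus l2 \<tau> (ddx_plus l2 \<tau> u) x = z * u x"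
    for u \<beta>
  proof -
    have u: "u \<in> W22 l2" "u \<in> L2 l2" "pointval l2 u 0 = \<beta> / r" "cnj w * pointval l2 u l2 = \<beta> / r"
      using dom by (auto simp: dom_Ahom_def W22_def W12_def w_def r_def)
    obtain A B where AB: "AE x in lebesgue_on {0<..<l2}. u x = sol s \<tau> A B x"
      using W22_solution[OF u(1) assms(4) \<open>s \<noteq> 0\<close>] eq unfolding z by metis
    note pu = pointval_sol[OF assms(4) u(2) AB]
    \<comment> \<open>Unimodularity of \<open>w\<close> converts the weighted condition at
      \<open>l2\<close> into the value \<open>\<beta> / r * w\<close> that \<open>jump\<close>
      expects.\<close>
    have "pointval l2 u l2 = w * (cnj w * pointval l2 u l2)"
      using ww by (simp add: mult.assoc[symmetric])
    then have ul: "pointval l2 u l2 = \<beta> / r * w"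
      unfolding u(4) by (simp add: mult.commute)
    have "sol s \<tau> A B 0 = \<beta> / r" "sol s \<tau> A B l2 = \<beta> / r * w"
      using pu(1)[of 0, symmetric] pu(1)[of l2, symmetric] assms(4) by (simp_all add: u(3) ul)
    from jump[OF this] have "Gamma_tau a1 a3 l1 l2 l3 \<epsilon> \<tau> (u, \<beta>) = \<beta> / r * (H + T)"
      using pu(2)[of 0] pu(2)[of l2] assms(4) by (simp add: Gamma algebra_simps add_divide_distrib)
    \<comment> \<open>One factor \<open>1 / r\<close> comes from the operator and one from the trace
      condition; together they give \<open>1 / (l1 + l3)\<close>.\<close>
    then have "snd (Ahom a1 a3 l1 l2 l3 \<epsilon> \<tau> (u, \<beta>)) = 1 / r * (\<beta> / r * (H + T))"
      by (simp add: Ahom_def r_def)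
    also have "\<dots> = 1 / (r * r) * (H + T) * \<beta>" by simp
    finally show ?thesis by (simp add: K r(2))
  qed
  with K show ?thesis by (simp add: H_def T_def k_def)
qed

end
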